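(* Let $\boldsymbol{X}_1,\boldsymbol{X}_2,\ldots$ be $d$-variate random vectors with a common continuous distribution whose copula is $C$. Suppose that for each $j\in\{1,\ldots,d\}$ the copula $C$ has a continuous first-order partial derivative $\dot C_j(\boldsymbol{u})=\partial C(\boldsymbol{u})/\partial u_j$ on the set $\{\boldsymbol{u}\in[0,1]^d:0<u_j<1\}$. Suppose moreover that the empirical copula process satisfies $\mathbb{G}_n\rightsquigarrow\mathbb{G}$ in $\ell^\infty([0,1]^d)$ as $n\to\infty$, the limiting process $\mathbb{G}$ having continuous trajectories almost surely. Let $\boldsymbol{m}=\boldsymbol{m}(n)\in\mathbb{N}^d$ be multi-indices such that $m_*=\min(m_1,\ldots,m_d)\to\infty$ as $n\to\infty$. (i) If $\sqrt n=o(m_* )$, then for all $\boldsymbol{u}\in(0,1]^d$ for which there exists $\varepsilon>0$ such that, for each $j\in\{1,\ldots,d\}$ with $u_j<1$, we have $0<u_j-\varepsilon<u_j+\varepsilon<1$ and $\dot C_j$ is Lipschitz on $\{\boldsymbol{w}\in[0,1]^d:|\boldsymbol{w}-\boldsymbol{u}|_\infty\le\varepsilon\}$, we have $$\mathbb{G}_{n,\boldsymbol{m}}(\boldsymbol{u})=\mathbb{G}_n(\boldsymbol{u})+o_P(1),\qquad n\to\infty.$$ (ii) If $\liminf_{n\to\infty}m_*/n>0$, then, in $\ell^\infty([0,1]^d)$, $$\mathbb{G}_{n,\boldsymbol{m}}=\mathbb{G}_n+o_P(1)\rightsquigarrow\mathbb{G},\qquad n\to\infty.$$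
   Context: $\mathbb{N}$ denotes the positive integers and $|\cdot|_\infty$ the maximum norm on $\mathbb{R}^d$. The copula $C$ of a continuous distribution function $F$ with margins $F_1,\ldots,F_d$ is the unique distribution function on $[0,1]^d$ with uniform margins satisfying $F(x_1,\ldots,x_d)=C(F_1(x_1),\ldots,F_d(x_d))$. The vectors $\boldsymbol{X}_i$ may be i.i.d. or, more generally, form a strictly stationary sequence; only the assumed weak convergence of $\mathbb{G}_n$ is used. Ranks: $R_{i,j}^{(n)}=\sum_{k=1}^n\mathbf{1}\{X_{k,j}\le X_{i,j}\}$. Empirical copula: $\mathbb{C}_n(\boldsymbol{u})=\frac1n\sum_{i=1}^n\prod_{j=1}^d\mathbf{1}\{R_{i,j}^{(n)}/n\le u_j\}$, $\boldsymbol{u}\in[0,1]^d$. For $f:[0,1]^d\to\mathbb{R}$, $$B_{\boldsymbol{m}}(f)(\boldsymbol{u})=\sum_{s_1=0}^{m_1}\cdots\sum_{s_d=0}^{m_d}f(s_1/m_1,\ldots,s_d/m_d)\prod_{j=1}^d\binom{m_j}{s_j}u_j^{s_j}(1-u_j)^{m_j-s_j}.$$ Empirical copula process: $\mathbb{G}_n=\sqrt n(\mathbb{C}_n-C)$. Empirical Bernstein copula process: $\mathbb{G}_{n,\boldsymbol{m}}=\sqrt n\{B_{\boldsymbol{m}}(\mathbb{C}_n)-C\}$. $\ell^\infty([0,1]^d)$ is the Banach space of bounded real functions on $[0,1]^d$ with the supremum norm; $\rightsquigarrow$ denotes weak convergence in the sense of van der Vaart and Wellner (Hoffmann-Jørgensen,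 with outer expectations). In (ii), $o_P(1)$ denotes a process whose supremum norm converges to $0$ in probability. *)

theory Defs
  imports "HOL-Probability.Probability" "HOL-Library.Landau_Symbols"
begin

section \<open>Distribution functions and copulas\<close>

definition unit_cube :: "(real ^ 'd) set" where
  "unit_cube = {u. \<forall>j. 0 \<le> u $ j \<and> u $ j \<le> 1}"

definition joint_cdf :: "(real ^ 'd) measure \<Rightarrow> real ^ 'd \<Rightarrow> real" where
  "joint_cdf P x = measure P {y. \<forall>j. y $ j \<le> x $ j}"

definition margin :: "(real ^ 'd) measure \<Rightarrow> 'd \<Rightarrow> real measure" where
  "margin P j = distr P borel (\<lambda>x. x $ j)"

text \<open>
  A copula lives on the unit cube only; the values of the total function \<open>C\<close> outside
  \<^const>\<open>unit_cube\<close> are irrelevant here and everywhere below.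
\<close>

definition is_copula :: "(real ^ 'd \<Rightarrow> real) \<Rightarrow> bool" where
  "is_copula C \<longleftrightarrow>
     (\<exists>Q :: (real ^ 'd) measure. prob_space Q \<and> sets Q = sets borel \<and>
        (\<forall>j. margin Q j = uniform_measure lborel {0..1}) \<and>
        (\<forall>u \<in> unit_cube. C u = joint_cdf Q u))"

definition copula_of :: "(real ^ 'd) measure \<Rightarrow> (real ^ 'd \<Rightarrow> real) \<Rightarrow> bool" where
  "copula_of P C \<longleftrightarrow>
     is_copula C \<and> (\<forall>x. joint_cdf P x = C (\<chi> j. cdf (margin P j) (x $ j)))"

text \<open>
  The partial derivative in direction \<open>j\<close> is the ordinary two-sided derivative of the section
  through \<open>u\<close>.  Where \<open>0 < u $ j < 1\<close>, a neighbourhood of \<open>u $ j\<close> stays in the cube, also if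
  other coordinates of \<open>u\<close> are on the boundary.
\<close>

definition section_at :: "(real ^ 'd \<Rightarrow> real) \<Rightarrow> 'd \<Rightarrow> real ^ 'd \<Rightarrow> real \<Rightarrow> real" where
  "section_at f j u t = f (\<chi> k. if k = j then t else u $ k)"

definition partial_deriv :: "(real ^ 'd \<Rightarrow> real) \<Rightarrow> 'd \<Rightarrow> real ^ 'd \<Rightarrow> real" where
  "partial_deriv f j u = deriv (section_at f j u) (u $ j)"

definition has_continuous_partial_on ::
    "(real ^ 'd \<Rightarrow> real) \<Rightarrow> 'd \<Rightarrow> (real ^ 'd) set \<Rightarrow> bool" where
  "has_continuous_partial_on f j V \<longleftrightarrow>
     (\<forall>u \<in> V. section_at f j u differentiable (at (u $ j))) \<and>
     continuous_on V (partial_deriv f j)"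


section \<open>Empirical copula and empirical Bernstein copula\<close>

text \<open>The sample is \<open>x 1, \<dots>, x n\<close>; the value \<open>x 0\<close> is never used.\<close>

definition sample_rank :: "(nat \<Rightarrow> real ^ 'd) \<Rightarrow> nat \<Rightarrow> nat \<Rightarrow> 'd \<Rightarrow> nat" where
  "sample_rank x n i j = (\<Sum>k = 1..n. of_bool (x k $ j \<le> x i $ j))"

definition empirical_copula :: "(nat \<Rightarrow> real ^ 'd) \<Rightarrow> nat \<Rightarrow> real ^ 'd \<Rightarrow> real" where
  "empirical_copula x n u =
     (1 / real n) * (\<Sum>i = 1..n. \<Prod>j \<in> UNIV. of_bool (real (sample_rank x n i j) / real n \<le> u $ j))"

definition bernstein :: "('d \<Rightarrow> nat) \<Rightarrow> (real ^ 'd \<Rightarrow> real) \<Rightarrow> real ^ 'd \<Rightarrow> real" where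
  "bernstein m f u =
     (\<Sum>s \<in> (\<Pi>\<^sub>E j \<in> UNIV. {0..m j}).
        f (\<chi> j. real (s j) / real (m j)) *
        (\<Prod>j \<in> UNIV. real (m j choose s j) * (u $ j) ^ s j * (1 - u $ j) ^ (m j - s j)))"

definition emp_process ::
    "(real ^ 'd \<Rightarrow> real) \<Rightarrow> (nat \<Rightarrow> real ^ 'd) \<Rightarrow> nat \<Rightarrow> real ^ 'd \<Rightarrow> real" where
  "emp_process C x n = (\<lambda>u \<in> unit_cube. sqrt (real n) * (empirical_copula x n u - C u))"

definition emp_bernstein_process ::
    "(real ^ 'd \<Rightarrow> real) \<Rightarrow> (nat \<Rightarrow> real ^ 'd) \<Rightarrow> nat \<Rightarrow> ('d \<Rightarrow> nat) \<Rightarrow> real ^ 'd \<Rightarrow> real" where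
  "emp_bernstein_process C x n m =
     (\<lambda>u \<in> unit_cube. sqrt (real n) * (bernstein m (empirical_copula x n) u - C u))"


section \<open>Weak convergence in the sense of Hoffmann-Joergensen\<close>

text \<open>
  \<^const>\<open>funspace\<close> consists of the bounded functions on \<open>T\<close> (represented extensionally), with the
  supremum distance.
\<close>

definition l_infty :: "'t set \<Rightarrow> ('t \<Rightarrow> real) metric" where
  "l_infty T = funspace T euclidean_metric"

definition borel_of_metric :: "'s metric \<Rightarrow> 's measure" where
  "borel_of_metric m = sigma (mspace m) {U. openin (mtopology_of m) U}"

text \<open>
  Only meant for bounded \<open>Z\<close>.  For such \<open>Z\<close>, admitting extended real majorants whose expectation
  exists would not change the infimum.
\<close>

definition outer_expectation :: "'a measure \<Rightarrow> ('a \<Rightarrow> real) \<Rightarrow> real" where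
  "outer_expectation M Z =
     Inf {integral\<^sup>L M U | U. integrable M U \<and> (\<forall>\<omega> \<in> space M. Z \<omega> \<le> U \<omega>)}"

text \<open>The \<open>Y n\<close> are arbitrary maps into the metric space, only the limit is Borel measurable.\<close>

definition converges_weakly ::
    "'s metric \<Rightarrow> 'a measure \<Rightarrow> (nat \<Rightarrow> 'a \<Rightarrow> 's) \<Rightarrow> 'b measure \<Rightarrow> ('b \<Rightarrow> 's) \<Rightarrow> bool" where
  "converges_weakly m M Y N L \<longleftrightarrow>
     (\<forall>n. Y n \<in> space M \<rightarrow> mspace m) \<and>
     L \<in> measurable N (borel_of_metric m) \<and>
     (\<forall>h :: 's \<Rightarrow> real.
        continuous_map (mtopology_of m) euclideanreal h \<and> bounded (h ` mspace m) \<longrightarrow>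
        (\<lambda>n. outer_expectation M (\<lambda>\<omega>. h (Y n \<omega>))) \<longlonglongrightarrow> (\<integral>\<omega>. h (L \<omega>) \<partial>N))"

text \<open>
  \<open>Z n = o\<^sub>P(1)\<close>; outer probability, so that nothing is lost should \<open>Z n\<close> fail to be measurable.
\<close>

definition is_oP1 :: "'a measure \<Rightarrow> (nat \<Rightarrow> 'a \<Rightarrow> real) \<Rightarrow> bool" where
  "is_oP1 M Z \<longleftrightarrow>
     (\<forall>\<delta> > 0. (\<lambda>n. outer_measure_of M {\<omega> \<in> space M. \<bar>Z n \<omega>\<bar> > \<delta>}) \<longlonglongrightarrow> 0)"

end

theory Submission
  imports Defs
begin

text \<open>
  The Bernstein operator averages a function against the product law of the scaled binomials
  \<open>S\<^sub>j / m\<^sub>j\<close>, so the difference of the two processes is the average of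
  \<open>G\<^sub>n(w) - G\<^sub>n(u)\<close> plus the bias \<open>\<surd>n (B\<^sub>m(C) - C)(u)\<close>.

  The first term is controlled by the functional \<open>sup\<^sub>u\<^sub>,\<^sub>w (\<bar>g w - g u\<bar> - k dist w u)\<close>, which is Lipschitz
  in the supremum norm and tends to \<open>0\<close> as \<open>k \<rightarrow> \<infinity>\<close> for continuous \<open>g\<close>; weak convergence applied to it
  yields asymptotic equicontinuity in one stroke.

  In the bias, the linear part of \<open>C\<close> at \<open>u\<close> averages to zero, and the remainder is bounded through a
  modulus of continuity of the partial derivatives. These may be discontinuous where \<open>u\<^sub>j \<in> {0, 1}\<close>,
  but there the binomial variance \<open>u\<^sub>j (1 - u\<^sub>j) / m\<^sub>j\<close> is small.
\<close>

subsection \<open>Outer expectation and weak convergence\<close>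

text \<open>The processes need not be measurable as maps into the space of bounded functions, and
  outer expectation is not linear. Estimates under it therefore pass through integrable majorants
  and measurable covers. The slope \<open>k\<close> in the functional is chosen from the limit
  process alone, before \<open>n\<close>; with \<open>k\<close> fixed, the mean distance from the
  nodes to \<open>u\<close>, of order \<open>1 / sqrt mstar\<close>, costs nothing in the limit. The
  two growth conditions come from the bias, which must be o(1 / sqrt n). With Lipschitz derivatives
  near \<open>u\<close> it is O(1 / mstar), so sqrt n = o(mstar) suffices. Uniformly in
  \<open>u\<close> only continuity is at hand, and the bound is
  \<open>e / sqrt mstar + K / mstar\<close> for each \<open>e > 0\<close>, where nothing is known
  about the growth of \<open>K\<close> as \<open>e\<close> shrinks. If mstar is at least c n,
  multiplication by sqrt n leaves at most \<open>e / sqrt c\<close>, small by choice of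
  \<open>e\<close>, plus a term of order 1 / sqrt n for whatever \<open>K\<close> results. The
  first-order term averages to zero for every choice of slopes, so slope 0 may replace a derivative
  at points near or on a face, where it is uncontrolled.\<close>

lemma (in prob_space) bdd_below_majorant_integrals:
  fixes Z :: "'a \<Rightarrow> real"
  assumes "\<And>\<omega>. \<omega> \<in> space M \<Longrightarrow> b \<le> Z \<omega>"
  shows "bdd_below {integral\<^sup>L M U | U. integrable M U \<and> (\<forall>\<omega> \<in> space M. Z \<omega> \<le> U \<omega>)}"
proof (rule bdd_belowI[where m=b], clarify)
  fix U assume U: "integrable M U" "\<forall>\<omega> \<in> space M. Z \<omega> \<le> U \<omega>"
  have "b = (\<integral>\<omega>. b \<partial>M)" by (simp add: prob_space)
  also have "\<dots> \<le> integral\<^sup>L M U"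
    by (rule integral_mono) (use U assms in \<open>auto intro: order_trans\<close>)
  finally show "b \<le> integral\<^sup>L M U" .
qed

text \<open>A nonmeasurable \<open>Z\<close> is handled through a nearly optimal integrable
  majorant. The bound \<open>B\<close> supplies a constant majorant, so the infimum is over a
  nonempty set and can be approached.\<close>

lemma (in prob_space) outer_expectation_lessD:
  assumes "\<And>\<omega>. \<omega> \<in> space M \<Longrightarrow> Z \<omega> \<le> B" and "outer_expectation M Z < c"
  obtains U where "integrable M U" "\<And>\<omega>. \<omega> \<in> space M \<Longrightarrow> Z \<omega> \<le> U \<omega>" "integral\<^sup>L M U < c"
proof -
  let ?S = "{integral\<^sup>L M U | U. integrable M U \<and> (\<forall>\<omega> \<in> space M. Z \<omega> \<le> U \<omega>)}"
  have "integral\<^sup>L M (\<lambda>_. B) \<in> ?S" using assms(1) by (blast intro: integrable_const)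
  then have "?S \<noteq> {}" by blast
  from cInf_lessD[OF this] assms(2) show thesis
    unfolding outer_expectation_def using that by blast
qed

text \<open>Adding \<open>V\<close> to a nearly optimal majorant of \<open>Z\<close> gives a
  majorant of \<open>Z'\<close>, and the integral of \<open>V\<close> splits off exactly. The upper
  bound on \<open>Z\<close> provides a majorant to start from; the lower bound on \<open>Z'\<close>
  makes its infimum a genuine lower bound.\<close>

lemma (in prob_space) outer_expectation_le_add:
  assumes bdd: "\<And>\<omega>. \<omega> \<in> space M \<Longrightarrow> Z \<omega> \<le> B" "\<And>\<omega>. \<omega> \<in> space M \<Longrightarrow> b \<le> Z' \<omega>"
    and V: "integrable M V" and le: "\<And>\<omega>. \<omega> \<in> space M \<Longrightarrow> Z' \<omega> \<le> Z \<omega> + V \<omega>"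
  shows "outer_expectation M Z' \<le> outer_expectation M Z + integral\<^sup>L M V"
proof (rule field_le_epsilon)
  fix e :: real assume "e > 0"
  then have "outer_expectation M Z < outer_expectation M Z + e" by simp
  then obtain U where U: "integrable M U" "\<And>\<omega>. \<omega> \<in> space M \<Longrightarrow> Z \<omega> \<le> U \<omega>"
      "integral\<^sup>L M U < outer_expectation M Z + e"
    using outer_expectation_lessD[of Z B] bdd(1) by blast
  have le': "Z' \<omega> \<le> U \<omega> + V \<omega>" if "\<omega> \<in> space M" for \<omega>
    using le[OF that] U(2)[OF that] by linarith
  have "outer_expectation M Z' \<le> integral\<^sup>L M (\<lambda>\<omega>. U \<omega> + V \<omega>)"
    unfolding outer_expectation_def
  proof (rule cInf_lower[OF _ bdd_below_majorant_integrals[OF bdd(2)]])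
    have "integrable M (\<lambda>\<omega>. U \<omega> + V \<omega>)" using U(1) V by simp
    with le'
    show "integral\<^sup>L M (\<lambda>\<omega>. U \<omega> + V \<omega>)
        \<in> {integral\<^sup>L M U | U. integrable M U \<and> (\<forall>\<omega>\<in>space M. Z' \<omega> \<le> U \<omega>)}" by blast
  qed
  also have "\<dots> = integral\<^sup>L M U + integral\<^sup>L M V" using U V by simp
  finally show "outer_expectation M Z' \<le> outer_expectation M Z + integral\<^sup>L M V + e"
    using U(3) by simp
qed

lemma (in prob_space) outer_expectation_mono:
  assumes "\<And>\<omega>. \<omega> \<in> space M \<Longrightarrow> Z \<omega> \<le> B" "\<And>\<omega>. \<omega> \<in> space M \<Longrightarrow> b \<le> Z' \<omega>"
    and "\<And>\<omega>. \<omega> \<in> space M \<Longrightarrow> Z' \<omega> \<le> Z \<omega>"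
  shows "outer_expectation M Z' \<le> outer_expectation M Z"
  using outer_expectation_le_add[of Z B b Z' "\<lambda>_. 0"] assms by simp

text \<open>Markov's inequality for an integrable majorant of the truncated variable. Truncation at
  1 makes it a bounded test function for weak convergence, and \<open>c \<le> 1\<close> ensures that
  the event \<open>c \<le> Z \<omega>\<close> survives the truncation.\<close>

lemma (in prob_space) outer_measure_of_markov:
  assumes "0 < c" "c \<le> 1" "0 < e"
    and Z: "\<And>\<omega>. \<omega> \<in> space M \<Longrightarrow> 0 \<le> Z \<omega>" "outer_expectation M (\<lambda>\<omega>. min 1 (Z \<omega>)) < c * e"
  shows "outer_measure_of M {\<omega> \<in> space M. c \<le> Z \<omega>} \<le> ennreal e"
proof -
  obtain U where U: "integrable M U" "\<And>\<omega>. \<omega> \<in> space M \<Longrightarrow> min 1 (Z \<omega>) \<le> U \<omega>"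
      "integral\<^sup>L M U < c * e"
    using outer_expectation_lessD[of "\<lambda>\<omega>. min 1 (Z \<omega>)" 1 "c * e"] Z(2) by force
  have [measurable]: "U \<in> borel_measurable M" using U(1) by simp
  have "{\<omega> \<in> space M. c \<le> Z \<omega>} \<subseteq> {\<omega> \<in> space M. c \<le> U \<omega>}"
    using U(2) \<open>c \<le> 1\<close> by (smt (verit) Collect_mono)
  then have "outer_measure_of M {\<omega> \<in> space M. c \<le> Z \<omega>} \<le> outer_measure_of M {\<omega> \<in> space M. c \<le> U \<omega>}"
    by (rule outer_measure_of_mono)
  also have "\<dots> = emeasure M {\<omega> \<in> space M. c \<le> U \<omega>}"
    by (rule outer_measure_of_eq) measurable
  also have "\<dots> = ennreal (prob {\<omega> \<in> space M. c \<le> U \<omega>})"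
    by (simp add: emeasure_eq_measure)
  also have "prob {\<omega> \<in> space M. c \<le> U \<omega>} \<le> integral\<^sup>L M U / c"
  proof (rule integral_Markov_inequality_measure[where A = "{}"])
    show "AE \<omega> in M. 0 \<le> U \<omega>" using U(2) Z(1) by (intro AE_I2) (smt (verit))
  qed (use U(1) \<open>0 < c\<close> in auto)
  also have "\<dots> \<le> e" using U(3) assms by (simp add: field_simps)
  finally show ?thesis using ennreal_leI by auto
qed

section \<open>Continuous functions on a metric space and their Lipschitz approximation\<close>

lemma continuous_map_lipschitz:
  assumes "\<And>x y. x \<in> mspace m \<Longrightarrow> y \<in> mspace m \<Longrightarrow> \<bar>f x - f y\<bar> \<le> K * mdist m x y"
  shows "continuous_map (mtopology_of m) euclideanreal f"
proof -
  have "Lipschitz_continuous_map m euclidean_metric f"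
    unfolding Lipschitz_continuous_map_def using assms by (auto simp: dist_real_def)
  from Lipschitz_continuous_imp_continuous_map[OF this] show ?thesis by simp
qed

lemma space_borel_of_metric [simp]: "space (borel_of_metric m) = mspace m"
  by (simp add: borel_of_metric_def space_measure_of_conv)

lemma borel_measurable_continuous_map:
  assumes "continuous_map (mtopology_of m) euclideanreal h"
  shows "h \<in> borel_measurable (borel_of_metric m)"
proof (rule borel_measurableI)
  fix S :: "real set" assume "open S"
  then have "openin (mtopology_of m) {x \<in> mspace m. h x \<in> S}"
    using openin_continuous_map_preimage[OF assms, of S] by simp
  moreover have "h -` S \<inter> space (borel_of_metric m) = {x \<in> mspace m. h x \<in> S}" by auto
  moreover have "{U. openin (mtopology_of m) U} \<subseteq> Pow (mspace m)"
    using openin_subset by fastforce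
  ultimately show "h -` S \<inter> space (borel_of_metric m) \<in> sets (borel_of_metric m)"
    by (simp add: borel_of_metric_def)
qed

text \<open>Infimal convolution of \<open>h\<close> with \<open>k\<close> times the distance, that
  is, the largest \<open>k\<close>-Lipschitz function below \<open>h\<close>. The space need not be
  compact, so convergence is only pointwise, which is enough for dominated convergence under the
  limit law.\<close>

lemma lipschitz_minorants:
  fixes h :: "'s \<Rightarrow> real"
  assumes h: "continuous_map (mtopology_of m) euclideanreal h"
    and B: "\<And>x. x \<in> mspace m \<Longrightarrow> \<bar>h x\<bar> \<le> B"
  obtains g :: "nat \<Rightarrow> 's \<Rightarrow> real"
  where "\<And>k x y. x \<in> mspace m \<Longrightarrow> y \<in> mspace m \<Longrightarrow> \<bar>g k x - g k y\<bar> \<le> real k * mdist m x y"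
    and "\<And>k x. x \<in> mspace m \<Longrightarrow> \<bar>g k x\<bar> \<le> B"
    and "\<And>k x. x \<in> mspace m \<Longrightarrow> g k x \<le> h x"
    and "\<And>x. x \<in> mspace m \<Longrightarrow> (\<lambda>k. g k x) \<longlonglongrightarrow> h x"
proof
  define g where "g k x = (INF y\<in>mspace m. h y + real k * mdist m x y)" for k x
  have nonneg: "0 \<le> real k * mdist m x y" for k x y by simp
  have bdd: "bdd_below ((\<lambda>y. h y + real k * mdist m x y) ` mspace m)" if "x \<in> mspace m" for k x
  proof (rule bdd_belowI2[where m="-B"])
    fix y assume "y \<in> mspace m"
    then show "- B \<le> h y + real k * mdist m x y"
      using B[of y] nonneg[of k x y] by linarith
  qed
  have upper: "g k x \<le> h y + real k * mdist m x y" if "x \<in> mspace m" "y \<in> mspace m" for k x y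
    unfolding g_def by (rule cINF_lower[OF bdd[OF that(1)] that(2)])
  show le: "g k x \<le> h x" if "x \<in> mspace m" for k x
    using upper[OF that that, of k] mdist_zero[OF that that] by simp
  have ge: "- B \<le> g k x" if "x \<in> mspace m" for k x
    unfolding g_def
  proof (rule cINF_greatest)
    fix y assume "y \<in> mspace m"
    then show "- B \<le> h y + real k * mdist m x y"
      using B[of y] nonneg[of k x y] by linarith
  qed (use that in blast)
  show "\<bar>g k x\<bar> \<le> B" if "x \<in> mspace m" for k x
    using le[OF that] ge[OF that] B[OF that] by (smt (verit))
  have lip: "g k x \<le> g k y + real k * mdist m x y" if "x \<in> mspace m" "y \<in> mspace m" for k x y
  proof -
    have "g k x - real k * mdist m x y \<le> g k y"
      unfolding g_def[of k y]
    proof (rule cINF_greatest)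
      fix z assume z: "z \<in> mspace m"
      have "g k x \<le> h z + real k * mdist m x z" by (rule upper[OF that(1) z])
      also have "\<dots> \<le> h z + real k * (mdist m x y + mdist m y z)"
        using mdist_triangle[OF that z] by (simp add: mult_left_mono)
      finally show "g k x - real k * mdist m x y \<le> h z + real k * mdist m y z"
        by (simp add: algebra_simps)
    qed (use that in blast)
    then show ?thesis by simp
  qed
  show "\<bar>g k x - g k y\<bar> \<le> real k * mdist m x y" if "x \<in> mspace m" "y \<in> mspace m" for k x y
    using lip[OF that, of k] lip[OF that(2,1), of k] by (simp add: mdist_commute abs_le_iff)
  show "(\<lambda>k. g k x) \<longlonglongrightarrow> h x" if x: "x \<in> mspace m" for x
  proof (rule LIMSEQ_I)
    fix e :: real assume e: "e > 0"
    have "\<exists>d>0. \<forall>y\<in>mspace m. mdist m x y < d \<longrightarrow> \<bar>h y - h x\<bar> < e / 2"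
    proof -
      interpret Metric_space "mspace m" "mdist m" by simp
      have "continuous_map mtopology euclidean h" using h by (simp add: mtopology_of_def)
      then have "\<forall>a\<in>mspace m. \<forall>U. openin euclidean U \<and> h a \<in> U \<longrightarrow>
          (\<exists>r>0. \<forall>x. x \<in> mspace m \<and> mdist m a x < r \<longrightarrow> h x \<in> U)"
        unfolding continuous_map_from_metric by blast
      from this[rule_format, OF x, of "ball (h x) (e/2)"] e show ?thesis
        by (auto simp: dist_real_def abs_minus_commute)
    qed
    then obtain d where d: "d > 0" "\<And>y. y \<in> mspace m \<Longrightarrow> mdist m x y < d \<Longrightarrow> \<bar>h y - h x\<bar> < e / 2"
      by blast
    \<comment> \<open>From this \<open>k0\<close> on, a point at distance at least \<open>d\<close>
      from \<open>x\<close> costs \<open>2 * B\<close> or more, the maximal oscillation of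
      \<open>h\<close>; such a point cannot bring the infimum below \<open>h x\<close>.\<close>
    obtain k0 :: nat where k0: "2 * B / d \<le> real k0" using real_arch_simple by blast
    have "norm (g k x - h x) < e" if k: "k \<ge> k0" for k
    proof -
      have "h x - e / 2 \<le> g k x"
        unfolding g_def
      proof (rule cINF_greatest)
        fix y assume y: "y \<in> mspace m"
        show "h x - e / 2 \<le> h y + real k * mdist m x y"
        proof (cases "mdist m x y < d")
          case True
          then show ?thesis using d(2)[OF y True] nonneg[of k x y] by linarith
        next
          case False
          have "2 * B \<le> real k0 * d" using k0 d by (simp add: field_simps)
          also have "\<dots> \<le> real k * mdist m x y" using False k d by (intro mult_mono) auto
          finally show ?thesis using B[OF x] B[OF y] e by linarith
        qed
      qed (use x in blast)
      then show ?thesis using le[OF x, of k] e by simp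
    qed
    then show "\<exists>k0. \<forall>k\<ge>k0. norm (g k x - h x) < e" by blast
  qed
qed

text \<open>For Lipschitz test functions the claim is immediate; general ones are sandwiched between their
  Lipschitz minorants and, by symmetry, majorants.\<close>

lemma converges_weakly_oP1:
  assumes "prob_space M" "prob_space N"
    and Y: "converges_weakly m M Y N L"
    and Y': "\<And>n. Y' n \<in> space M \<rightarrow> mspace m"
    and d: "is_oP1 M (\<lambda>n \<omega>. mdist m (Y' n \<omega>) (Y n \<omega>))"
  shows "converges_weakly m M Y' N L"
proof -
  interpret M: prob_space M by fact
  interpret N: prob_space N by fact
  have Ysp: "Y n \<omega> \<in> mspace m" "Y' n \<omega> \<in> mspace m" if "\<omega> \<in> space M" for n \<omega>
    using Y Y' that unfolding converges_weakly_def by blast+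
  have L: "L \<in> measurable N (borel_of_metric m)" using Y unfolding converges_weakly_def by blast
  have Lsp: "L \<omega> \<in> mspace m" if "\<omega> \<in> space N" for \<omega>
    using measurable_space[OF L that] by simp
  have lipschitz: "(\<lambda>n. outer_expectation M (\<lambda>\<omega>. f (Y' n \<omega>))) \<longlonglongrightarrow> (\<integral>\<omega>. f (L \<omega>) \<partial>N)"
    if lip: "\<And>x y. x \<in> mspace m \<Longrightarrow> y \<in> mspace m \<Longrightarrow> \<bar>f x - f y\<bar> \<le> K * mdist m x y"
      and B: "\<And>x. x \<in> mspace m \<Longrightarrow> \<bar>f x\<bar> \<le> B" and KB: "0 \<le> K" "0 \<le> B" for f :: "_ \<Rightarrow> real" and K B
  proof -
    have lim: "(\<lambda>n. outer_expectation M (\<lambda>\<omega>. f (Y n \<omega>))) \<longlonglongrightarrow> (\<integral>\<omega>. f (L \<omega>) \<partial>N)"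
    proof -
      have "continuous_map (mtopology_of m) euclideanreal f" by (rule continuous_map_lipschitz[OF lip])
      moreover have "bounded (f ` mspace m)" using B by (auto simp: bounded_iff)
      ultimately show ?thesis using Y unfolding converges_weakly_def by blast
    qed
    have "(\<lambda>n. outer_expectation M (\<lambda>\<omega>. f (Y' n \<omega>)) - outer_expectation M (\<lambda>\<omega>. f (Y n \<omega>))) \<longlonglongrightarrow> 0"
    proof (rule LIMSEQ_I)
      fix e :: real assume "e > 0"
      \<comment> \<open>The budget \<open>e\<close> is split between the outcomes where the two
        processes are within \<open>\<delta>\<close>, costing \<open>K * \<delta>\<close>, and an
        exceptional event of outer probability below \<open>\<eta>\<close>, costing
        \<open>2 * B * \<eta>\<close>. The added 1 avoids division by zero.\<close>
      define \<delta> where "\<delta> = e / (2 * (K + 1))"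
      define \<eta> where "\<eta> = e / (4 * (B + 1))"
      have pos: "\<delta> > 0" "\<eta> > 0" using \<open>e > 0\<close> KB by (auto simp: \<delta>_def \<eta>_def)
      have K\<delta>: "K * \<delta> < e / 2" using KB(1) \<open>e > 0\<close> by (simp add: \<delta>_def field_simps)
      have B\<eta>: "2 * B * \<eta> < e / 2" using KB(2) \<open>e > 0\<close> by (simp add: \<eta>_def field_simps)
      define A where "A n = {\<omega> \<in> space M. \<bar>mdist m (Y' n \<omega>) (Y n \<omega>)\<bar> > \<delta>}" for n
      have "(\<lambda>n. outer_measure_of M (A n)) \<longlonglongrightarrow> 0"
        using d pos(1) unfolding is_oP1_def A_def by blast
      then have "eventually (\<lambda>n. outer_measure_of M (A n) < ennreal \<eta>) sequentially"
        using pos(2) by (intro order_tendstoD(2)) auto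
      then obtain n0 where n0: "\<And>n. n \<ge> n0 \<Longrightarrow> outer_measure_of M (A n) < ennreal \<eta>"
        unfolding eventually_sequentially by blast
      have "norm (outer_expectation M (\<lambda>\<omega>. f (Y' n \<omega>)) - outer_expectation M (\<lambda>\<omega>. f (Y n \<omega>)) - 0) < e"
        if n: "n \<ge> n0" for n
      proof -
        have "A n \<subseteq> space M" by (auto simp: A_def)
        \<comment> \<open>A measurable cover of the possibly nonmeasurable \<open>A n\<close> with
          the same measure, so that \<open>V\<close> below is integrable.\<close>
        then obtain E where E: "E \<in> sets M" "A n \<subseteq> E" "outer_measure_of M (A n) = emeasure M E"
          using outer_measure_of_attain by metis
        have "emeasure M E < ennreal \<eta>" using n0[OF n] E by simp
        then have mE: "measure M E < \<eta>"
          using pos(2) by (simp add: M.emeasure_eq_measure ennreal_less_iff)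
        define V where "V \<omega> = K * \<delta> + 2 * B * indicator E \<omega>" for \<omega>
        have V: "integrable M V" unfolding V_def using E(1)
          by (intro Bochner_Integration.integrable_add integrable_mult_right) (auto simp: M.emeasure_eq_measure)
        have "integral\<^sup>L M V = K * \<delta> + 2 * B * measure M E"
          unfolding V_def using E(1)
          by (subst Bochner_Integration.integral_add) (auto simp: M.prob_space M.emeasure_eq_measure)
        also have "\<dots> \<le> K * \<delta> + 2 * B * \<eta>" using mE KB(2) by (simp add: mult_left_mono)
        finally have VI: "integral\<^sup>L M V < e" using K\<delta> B\<eta> by linarith
        have le: "\<bar>f (Y' n \<omega>) - f (Y n \<omega>)\<bar> \<le> V \<omega>" if \<omega>: "\<omega> \<in> space M" for \<omega>
        proof (cases "\<omega> \<in> E")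
          case True
          have "0 \<le> K * \<delta>" using KB(1) pos by simp
          then show ?thesis using B[OF Ysp(1)[OF \<omega>], of n] B[OF Ysp(2)[OF \<omega>], of n] True
            by (simp add: V_def)
        next
          case False
          then have "\<omega> \<notin> A n" using E by blast
          then have "mdist m (Y' n \<omega>) (Y n \<omega>) \<le> \<delta>" using \<omega> by (simp add: A_def)
          then have "K * mdist m (Y' n \<omega>) (Y n \<omega>) \<le> K * \<delta>" using KB(1) by (rule mult_left_mono)
          then show ?thesis using lip[OF Ysp(2)[OF \<omega>] Ysp(1)[OF \<omega>], of n n] False by (simp add: V_def)
        qed
        have fY: "f (Y n \<omega>) \<le> B" "- B \<le> f (Y n \<omega>)" if "\<omega> \<in> space M" for \<omega>
          using B[OF Ysp(1)[OF that], of n] by auto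
        have fY': "f (Y' n \<omega>) \<le> B" "- B \<le> f (Y' n \<omega>)" if "\<omega> \<in> space M" for \<omega>
          using B[OF Ysp(2)[OF that], of n] by auto
        have le': "f (Y' n \<omega>) \<le> f (Y n \<omega>) + V \<omega>" "f (Y n \<omega>) \<le> f (Y' n \<omega>) + V \<omega>"
          if "\<omega> \<in> space M" for \<omega>
          using le[OF that] by linarith+
        have "outer_expectation M (\<lambda>\<omega>. f (Y' n \<omega>)) \<le> outer_expectation M (\<lambda>\<omega>. f (Y n \<omega>)) + integral\<^sup>L M V"
          by (rule M.outer_expectation_le_add[OF fY(1) fY'(2) V le'(1)])
        moreover have "outer_expectation M (\<lambda>\<omega>. f (Y n \<omega>)) \<le> outer_expectation M (\<lambda>\<omega>. f (Y' n \<omega>)) + integral\<^sup>L M V"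
          by (rule M.outer_expectation_le_add[OF fY'(1) fY(2) V le'(2)])
        ultimately show ?thesis using VI by simp
      qed
      then show "\<exists>n0. \<forall>n\<ge>n0. norm (outer_expectation M (\<lambda>\<omega>. f (Y' n \<omega>))
          - outer_expectation M (\<lambda>\<omega>. f (Y n \<omega>)) - 0) < e" by blast
    qed
    from tendsto_add[OF this lim] show ?thesis by simp
  qed
  \<comment> \<open>The sign treats both directions at once: for \<open>s = -1\<close> a minorant
    \<open>g k\<close> of \<open>- h\<close> yields the majorant \<open>- g k\<close> of
    \<open>h\<close>. Outer expectation does not commute with negation, so \<open>s\<close> appears
    both inside and outside it.\<close>
  have minorant: "eventually (\<lambda>n. (\<integral>\<omega>. s * h (L \<omega>) \<partial>N) - e < s * outer_expectation M (\<lambda>\<omega>. h (Y' n \<omega>))) sequentially"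
    if h: "continuous_map (mtopology_of m) euclideanreal h" and B: "\<And>x. x \<in> mspace m \<Longrightarrow> \<bar>h x\<bar> \<le> B"
      and "0 \<le> B" "0 < e" and s: "s \<in> {1, -1}" for h :: "_ \<Rightarrow> real" and B e s :: real
  proof -
    have ss: "s * s = 1" "\<bar>s\<bar> = 1" using s by auto
    have sh: "continuous_map (mtopology_of m) euclideanreal (\<lambda>x. s * h x)"
      using h by (intro continuous_intros)
    have sB: "\<bar>s * h x\<bar> \<le> B" if "x \<in> mspace m" for x using B[OF that] ss by (simp add: abs_mult)
    obtain g :: "nat \<Rightarrow> _ \<Rightarrow> real" where
      g: "\<And>k x y. x \<in> mspace m \<Longrightarrow> y \<in> mspace m \<Longrightarrow> \<bar>g k x - g k y\<bar> \<le> real k * mdist m x y"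
        "\<And>k x. x \<in> mspace m \<Longrightarrow> \<bar>g k x\<bar> \<le> B" "\<And>k x. x \<in> mspace m \<Longrightarrow> g k x \<le> s * h x"
        "\<And>x. x \<in> mspace m \<Longrightarrow> (\<lambda>k. g k x) \<longlonglongrightarrow> s * h x"
      using lipschitz_minorants[OF sh sB] by blast
    have meas: "(\<lambda>\<omega>. f (L \<omega>)) \<in> borel_measurable N" if "continuous_map (mtopology_of m) euclideanreal f" for f
      using measurable_compose[OF L borel_measurable_continuous_map[OF that]] .
    \<comment> \<open>Dominated convergence takes place on \<open>N\<close> only, where composition
      with \<open>L\<close> is measurable. It fixes \<open>k\<close>; the Lipschitz case then lets
      \<open>n\<close> grow.\<close>
    have "(\<lambda>k. \<integral>\<omega>. g k (L \<omega>) \<partial>N) \<longlonglongrightarrow> (\<integral>\<omega>. s * h (L \<omega>) \<partial>N)"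
      by (rule integral_dominated_convergence[where w="\<lambda>_. B"])
         (use g(2,4) Lsp meas[OF sh] meas[OF continuous_map_lipschitz[OF g(1)]] in simp_all)
    then have "eventually (\<lambda>k. (\<integral>\<omega>. s * h (L \<omega>) \<partial>N) - e < (\<integral>\<omega>. g k (L \<omega>) \<partial>N)) sequentially"
      using \<open>0 < e\<close> by (intro order_tendstoD(1)) auto
    then obtain k where k: "(\<integral>\<omega>. s * h (L \<omega>) \<partial>N) - e < (\<integral>\<omega>. g k (L \<omega>) \<partial>N)"
      unfolding eventually_sequentially by blast
    have lim: "(\<lambda>n. outer_expectation M (\<lambda>\<omega>. s * g k (Y' n \<omega>))) \<longlonglongrightarrow> (\<integral>\<omega>. s * g k (L \<omega>) \<partial>N)"
    proof (rule lipschitz)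
      fix x y assume "x \<in> mspace m" "y \<in> mspace m"
      then show "\<bar>s * g k x - s * g k y\<bar> \<le> real k * mdist m x y"
        using g(1)[of x y k] ss by (simp flip: right_diff_distrib add: abs_mult)
    qed (use g(2) ss \<open>0 \<le> B\<close> in \<open>auto simp: abs_mult\<close>)
    have "(\<lambda>n. s * outer_expectation M (\<lambda>\<omega>. s * g k (Y' n \<omega>))) \<longlonglongrightarrow> (\<integral>\<omega>. g k (L \<omega>) \<partial>N)"
      using tendsto_mult_left[OF lim, of s] ss(1) by (simp flip: mult.assoc)
    then have "eventually (\<lambda>n. (\<integral>\<omega>. s * h (L \<omega>) \<partial>N) - e < s * outer_expectation M (\<lambda>\<omega>. s * g k (Y' n \<omega>))) sequentially"
      using k by (rule order_tendstoD(1))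
    then show ?thesis
    proof eventually_elim
      case (elim n)
      have gY: "- B \<le> g k (Y' n \<omega>)" "- g k (Y' n \<omega>) \<le> B" if "\<omega> \<in> space M" for \<omega>
        using g(2)[OF Ysp(2)[OF that], of k n] by auto
      have hY: "h (Y' n \<omega>) \<le> B" "- B \<le> h (Y' n \<omega>)"
          "s = 1 \<Longrightarrow> g k (Y' n \<omega>) \<le> h (Y' n \<omega>)" "s = -1 \<Longrightarrow> h (Y' n \<omega>) \<le> - g k (Y' n \<omega>)"
        if "\<omega> \<in> space M" for \<omega>
        using B[OF Ysp(2)[OF that], of n] g(3)[OF Ysp(2)[OF that], of k n] by auto
      have "s * outer_expectation M (\<lambda>\<omega>. s * g k (Y' n \<omega>)) \<le> s * outer_expectation M (\<lambda>\<omega>. h (Y' n \<omega>))"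
      proof (cases "s = 1")
        case True
        have "outer_expectation M (\<lambda>\<omega>. g k (Y' n \<omega>)) \<le> outer_expectation M (\<lambda>\<omega>. h (Y' n \<omega>))"
          using True by (intro M.outer_expectation_mono[OF hY(1) gY(1)] hY(3)) simp_all
        then show ?thesis using True by simp
      next
        case False
        then have s: "s = -1" using s by simp
        have "outer_expectation M (\<lambda>\<omega>. h (Y' n \<omega>)) \<le> outer_expectation M (\<lambda>\<omega>. - g k (Y' n \<omega>))"
          using s by (intro M.outer_expectation_mono[OF gY(2) hY(2)] hY(4)) simp_all
        then show ?thesis using s by simp
      qed
      with elim show ?case by linarith
    qed
  qed
  have "(\<lambda>n. outer_expectation M (\<lambda>\<omega>. h (Y' n \<omega>))) \<longlonglongrightarrow> (\<integral>\<omega>. h (L \<omega>) \<partial>N)"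
    if h: "continuous_map (mtopology_of m) euclideanreal h" and bdd: "bounded (h ` mspace m)" for h :: "_ \<Rightarrow> real"
  proof -
    obtain B where "B > 0" and B: "\<And>x. x \<in> mspace m \<Longrightarrow> \<bar>h x\<bar> \<le> B"
      using bdd unfolding bounded_pos by auto
    show ?thesis
    proof (rule tendstoI)
      fix e :: real assume e: "e > 0"
      have "eventually (\<lambda>n. (\<integral>\<omega>. h (L \<omega>) \<partial>N) - e < outer_expectation M (\<lambda>\<omega>. h (Y' n \<omega>))) sequentially"
        using minorant[OF h B _ e, of 1] \<open>B > 0\<close> by simp
      moreover have "eventually (\<lambda>n. outer_expectation M (\<lambda>\<omega>. h (Y' n \<omega>)) < (\<integral>\<omega>. h (L \<omega>) \<partial>N) + e) sequentially"
        using minorant[OF h B _ e, of "-1"] \<open>B > 0\<close> by (simp add: algebra_simps)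
      ultimately show "eventually (\<lambda>n. dist (outer_expectation M (\<lambda>\<omega>. h (Y' n \<omega>))) (\<integral>\<omega>. h (L \<omega>) \<partial>N) < e) sequentially"
        by eventually_elim (auto simp: dist_real_def)
    qed
  qed
  then show ?thesis unfolding converges_weakly_def using Y' L by blast
qed

subsection \<open>Bernstein weights\<close>

definition grid :: "('d \<Rightarrow> nat) \<Rightarrow> ('d \<Rightarrow> nat) set" where
  "grid m = (\<Pi>\<^sub>E j \<in> UNIV. {..m j})"

definition node :: "('d \<Rightarrow> nat) \<Rightarrow> ('d \<Rightarrow> nat) \<Rightarrow> real ^ 'd" where
  "node m s = (\<chi> j. real (s j) / real (m j))"

definition weight :: "('d::finite \<Rightarrow> nat) \<Rightarrow> real ^ 'd \<Rightarrow> ('d \<Rightarrow> nat) \<Rightarrow> real" where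
  "weight m u s = (\<Prod>j\<in>UNIV. Bernstein (m j) (s j) (u $ j))"

lemma bernstein_eq_weighted_sum: "bernstein m f u = (\<Sum>s\<in>grid m. weight m u s * f (node m s))"
  unfolding bernstein_def grid_def node_def weight_def Bernstein_def
  by (simp add: atMost_atLeast0 mult.commute)

lemma weight_nonneg: "u \<in> unit_cube \<Longrightarrow> 0 \<le> weight m u s"
  unfolding weight_def unit_cube_def by (intro prod_nonneg) (auto intro: Bernstein_nonneg)

lemma node_in_unit_cube: "s \<in> grid m \<Longrightarrow> node m s \<in> unit_cube"
  by (auto simp: grid_def node_def unit_cube_def PiE_iff divide_le_eq_1)

text \<open>Marginalization of a product law: \<open>g\<close> is placed in coordinate
  \<open>j\<close> only, and the sums over all other coordinates equal 1. This reduces the moments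
  of one coordinate to binomial sums in one variable.\<close>

lemma sum_weight_coordinate:
  fixes m :: "'d::finite \<Rightarrow> nat"
  shows "(\<Sum>s\<in>grid m. weight m u s * g (s j)) = (\<Sum>k\<le>m j. Bernstein (m j) k (u $ j) * g k)"
proof -
  have "(\<Sum>k\<le>m j. Bernstein (m j) k (u $ j) * g k)
      = (\<Prod>i\<in>UNIV. \<Sum>k\<le>m i. Bernstein (m i) k (u $ i) * (if i = j then g k else 1))"
    by (subst prod.remove[of _ j]) auto
  also have "\<dots> = (\<Sum>s\<in>grid m. \<Prod>i\<in>UNIV. Bernstein (m i) (s i) (u $ i) * (if i = j then g (s i) else 1))"
    unfolding grid_def by (rule prod_sum_PiE) auto
  also have "\<dots> = (\<Sum>s\<in>grid m. weight m u s * g (s j))"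
    unfolding weight_def prod.distrib by (simp add: prod.delta)
  finally show ?thesis by simp
qed

lemma sum_weight: "(\<Sum>s\<in>grid m. weight m u s) = 1"
  \<comment> \<open>For the constant 1 any coordinate serves, hence
    \<open>undefined\<close>.\<close>
  using sum_weight_coordinate[of m u "\<lambda>_. 1" undefined] by simp

lemma sum_weight_deviation:
  assumes "1 \<le> m j"
  shows "(\<Sum>s\<in>grid m. weight m u s * (node m s $ j - u $ j)) = 0"
proof -
  have "(\<Sum>k\<le>m j. Bernstein (m j) k (u $ j) * (real k / real (m j) - u $ j))
      = (\<Sum>k\<le>m j. real k * Bernstein (m j) k (u $ j)) / real (m j)
        - u $ j * (\<Sum>k\<le>m j. Bernstein (m j) k (u $ j))"
    unfolding sum_divide_distrib sum_distrib_left sum_subtractf[symmetric]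
    by (intro sum.cong refl) (simp add: algebra_simps)
  also have "\<dots> = 0" using assms by simp
  finally show ?thesis using sum_weight_coordinate[of m u "\<lambda>k. real k / real (m j) - u $ j" j]
    by (simp add: node_def)
qed

text \<open>Writing \<open>k\<^sup>2\<close> as \<open>k * (k - 1) + k\<close> expresses the
  variance through the first two factorial moments of the binomial law.\<close>

lemma sum_weight_deviation_square:
  assumes "1 \<le> m j"
  shows "(\<Sum>s\<in>grid m. weight m u s * (node m s $ j - u $ j)\<^sup>2) = u $ j * (1 - u $ j) / real (m j)"
proof -
  let ?n = "real (m j)" and ?x = "u $ j"
  have "(\<Sum>k\<le>m j. Bernstein (m j) k ?x * (real k / ?n - ?x)\<^sup>2)
      = (\<Sum>k\<le>m j. (real k * (real k - 1) * Bernstein (m j) k ?x) / ?n\<^sup>2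
          + (1 / ?n\<^sup>2 - 2 * ?x / ?n) * (real k * Bernstein (m j) k ?x) + ?x\<^sup>2 * Bernstein (m j) k ?x)"
    by (intro sum.cong refl) (use assms in \<open>simp add: field_simps power2_eq_square\<close>)
  also have "\<dots> = (\<Sum>k\<le>m j. real k * (real k - 1) * Bernstein (m j) k ?x) / ?n\<^sup>2
      + (1 / ?n\<^sup>2 - 2 * ?x / ?n) * (\<Sum>k\<le>m j. real k * Bernstein (m j) k ?x)
      + ?x\<^sup>2 * (\<Sum>k\<le>m j. Bernstein (m j) k ?x)"
    unfolding sum.distrib sum_distrib_left sum_divide_distrib ..
  also have "\<dots> = ?x * (1 - ?x) / ?n"
    using assms unfolding sum_Bernstein sum_k_Bernstein sum_kk_Bernstein
    by (simp add: field_simps power2_eq_square)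
  finally show ?thesis using sum_weight_coordinate[of m u "\<lambda>k. (real k / ?n - ?x)\<^sup>2" j]
    by (simp add: node_def)
qed

text \<open>Jensen's inequality, from nonnegativity of the variance of the absolute deviation about
  its mean \<open>a\<close>. The factor \<open>u $ j * (1 - u $ j)\<close> is kept because the bias
  estimate near the faces of the cube relies on it.\<close>

lemma sum_weight_abs_deviation:
  assumes "1 \<le> m j" and u: "u \<in> unit_cube"
  shows "(\<Sum>s\<in>grid m. weight m u s * \<bar>node m s $ j - u $ j\<bar>) \<le> sqrt (u $ j * (1 - u $ j) / real (m j))"
proof -
  define a where "a = (\<Sum>s\<in>grid m. weight m u s * \<bar>node m s $ j - u $ j\<bar>)"
  have "0 \<le> (\<Sum>s\<in>grid m. weight m u s * (\<bar>node m s $ j - u $ j\<bar> - a)\<^sup>2)"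
    using weight_nonneg[OF u] by (intro sum_nonneg) simp
  also have "\<dots> = (\<Sum>s\<in>grid m. weight m u s * (node m s $ j - u $ j)\<^sup>2
      - 2 * a * (weight m u s * \<bar>node m s $ j - u $ j\<bar>) + a\<^sup>2 * weight m u s)"
    by (intro sum.cong refl) (simp add: power2_diff algebra_simps)
  also have "\<dots> = u $ j * (1 - u $ j) / real (m j) - 2 * a * a + a\<^sup>2"
    unfolding sum.distrib sum_subtractf
    by (simp only: sum_distrib_left[symmetric] sum_weight sum_weight_deviation_square[of m j, OF assms(1)] a_def)
  finally have "a\<^sup>2 \<le> u $ j * (1 - u $ j) / real (m j)" by (simp add: power2_eq_square)
  then show ?thesis unfolding a_def[symmetric] by (rule real_le_rsqrt)
qed

lemma variance_le_quarter: "x * (1 - x) \<le> 1 / (4 :: real)"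
  using zero_le_power2[of "x - 1/2"] by (simp add: power2_eq_square algebra_simps)

subsection \<open>Regularity of copulas\<close>

lemma unit_cube_update:
  "u \<in> unit_cube \<Longrightarrow> 0 \<le> t \<Longrightarrow> t \<le> 1 \<Longrightarrow> (\<chi> k. if k = j then t else u $ k) \<in> unit_cube"
  by (simp add: unit_cube_def)

text \<open>The increment is the mass of a difference of two lower orthants, which lies in the strip
  \<open>s < y $ j \<le> t\<close>; the uniform margin gives this strip mass
  \<open>t - s\<close>.\<close>

lemma copula_section_increment:
  fixes C :: "real ^ 'd \<Rightarrow> real"
  assumes C: "is_copula C" and u: "u \<in> unit_cube" and st: "0 \<le> s" "s \<le> t" "t \<le> 1"
  shows "\<bar>section_at C j u t - section_at C j u s\<bar> \<le> t - s"
proof -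
  obtain Q :: "(real ^ 'd) measure" where Q: "prob_space Q" and [measurable_cong]: "sets Q = sets borel"
    and margin: "margin Q j = uniform_measure lborel {0..1}"
    and CQ: "\<And>u. u \<in> unit_cube \<Longrightarrow> C u = joint_cdf Q u"
    using C unfolding is_copula_def by auto
  interpret prob_space Q by fact
  have spQ: "space Q = UNIV" using \<open>sets Q = sets borel\<close> sets_eq_imp_space_eq by fastforce
  define A where "A r = {y :: real ^ 'd. \<forall>k. y $ k \<le> (\<chi> k. if k = j then r else u $ k) $ k}" for r
  have meas: "A r \<in> sets Q" for r
  proof -
    have "closed (A r)" unfolding A_def by (intro closed_Collect_all closed_Collect_le continuous_intros)
    then show ?thesis using \<open>sets Q = sets borel\<close> by simp
  qed
  have sec: "section_at C j u r = prob (A r)" if "0 \<le> r" "r \<le> 1" for r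
    using CQ[OF unit_cube_update[OF u that]] by (simp add: section_at_def joint_cdf_def A_def)
  have sub: "A s \<subseteq> A t" using st by (auto simp: A_def split: if_splits)
  have strip: "{y. s < y $ j \<and> y $ j \<le> t} \<in> sets Q"
  proof -
    have [measurable]: "(\<lambda>y :: real ^ 'd. y $ j) \<in> borel_measurable borel"
      by (intro borel_measurable_continuous_onI continuous_intros)
    have "{y \<in> space borel. s < y $ j \<and> y $ j \<le> t} \<in> sets (borel :: (real ^ 'd) measure)" by measurable
    then show ?thesis using \<open>sets Q = sets borel\<close> by simp
  qed
  have "prob (A t) - prob (A s) = prob (A t - A s)"
    by (rule finite_measure_Diff[symmetric]) (use meas sub in auto)
  also have "\<dots> \<le> prob {y. s < y $ j \<and> y $ j \<le> t}"
  proof (rule finite_measure_mono)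
    show "A t - A s \<subseteq> {y. s < y $ j \<and> y $ j \<le> t}"
      by (auto simp: A_def split: if_splits)
  qed (rule strip)
  also have "\<dots> = measure (margin Q j) {s<..t}"
    unfolding margin_def
    by (subst measure_distr) (simp_all add: spQ vimage_def)
  also have "\<dots> = t - s"
    unfolding margin using st by (subst measure_uniform_measure) (auto simp: Int_absorb1 subset_iff)
  finally show ?thesis using sec[of s] sec[of t] st finite_measure_mono[OF sub meas] by simp
qed

lemma copula_section_lipschitz:
  assumes "is_copula C" "u \<in> unit_cube" "s \<in> {0..1}" "t \<in> {0..1}"
  shows "\<bar>section_at C j u t - section_at C j u s\<bar> \<le> \<bar>t - s\<bar>"
  using copula_section_increment[OF assms(1,2), of s t j] copula_section_increment[OF assms(1,2), of t s j]
    assms(3,4) by (cases "s \<le> t") auto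

section \<open>Partial derivatives of a copula and first-order expansion\<close>

lemma section_at_update: "section_at f j (\<chi> k. if k = j then t else u $ k) = section_at f j u"
  by (auto simp: section_at_def fun_eq_iff intro!: arg_cong[where f=f] simp: vec_eq_iff)

lemma section_at_self: "section_at f j u (u $ j) = f u"
  by (auto simp: section_at_def intro!: arg_cong[where f=f] simp: vec_eq_iff)

text \<open>Moving coordinate \<open>j\<close> does not change the section, so the hypothesis at the
  moved point applies. The base point may have \<open>u $ j\<close> equal to 0 or 1, as happens when
  a path starts on a face.\<close>

lemma section_has_partial_deriv:
  assumes "has_continuous_partial_on C j {u \<in> unit_cube. 0 < u $ j \<and> u $ j < 1}"
    and "u \<in> unit_cube" "0 < t" "t < 1"
  shows "(section_at C j u has_field_derivative partial_deriv C j (\<chi> k. if k = j then t else u $ k)) (at t)"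
proof -
  let ?v = "\<chi> k. if k = j then t else u $ k"
  have "?v \<in> {u \<in> unit_cube. 0 < u $ j \<and> u $ j < 1}" using assms by (simp add: unit_cube_update)
  then have "section_at C j ?v differentiable (at (?v $ j))"
    using assms(1) unfolding has_continuous_partial_on_def by blast
  then show ?thesis
    unfolding partial_deriv_def section_at_update
    by (simp add: field_differentiable_derivI real_differentiable_def field_differentiable_def)
qed

text \<open>The difference quotients of a 1-Lipschitz section are at most 1, hence so is their
  limit. The bound is uniform up to the faces, where the derivative may have no continuous
  extension.\<close>

lemma abs_partial_deriv_copula_le:
  assumes C: "is_copula C" and D: "has_continuous_partial_on C j {u \<in> unit_cube. 0 < u $ j \<and> u $ j < 1}"
    and u: "u \<in> unit_cube" "0 < u $ j" "u $ j < 1"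
  shows "\<bar>partial_deriv C j u\<bar> \<le> 1"
proof -
  let ?f = "section_at C j u" and ?x = "u $ j"
  have "(\<chi> k. if k = j then u $ j else u $ k) = u" by (simp add: vec_eq_iff)
  then have "(?f has_field_derivative partial_deriv C j u) (at ?x)"
    using section_has_partial_deriv[OF D u] by simp
  then have "((\<lambda>h. \<bar>(?f (?x + h) - ?f ?x) / h\<bar>) \<longlongrightarrow> \<bar>partial_deriv C j u\<bar>) (at 0)"
    unfolding DERIV_def by (rule tendsto_rabs)
  moreover have "eventually (\<lambda>h. \<bar>(?f (?x + h) - ?f ?x) / h\<bar> \<le> 1) (at 0)"
    unfolding eventually_at
  proof (intro exI[of _ "min ?x (1 - ?x)"] conjI ballI impI)
    fix h :: real assume h: "h \<noteq> 0 \<and> dist h 0 < min ?x (1 - ?x)"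
    then have "\<bar>?f (?x + h) - ?f ?x\<bar> \<le> \<bar>?x + h - ?x\<bar>"
      using u by (intro copula_section_lipschitz[OF C u(1)]) (auto simp: dist_real_def)
    then show "\<bar>(?f (?x + h) - ?f ?x) / h\<bar> \<le> 1" using h by (simp add: abs_divide)
  qed (use u in auto)
  ultimately show ?thesis by (rule tendsto_upperbound) simp
qed

text \<open>Mean value theorem between \<open>v $ j\<close> and \<open>t\<close>. The intermediate
  point is strictly inside, so \<open>b\<close> is required only where the derivative exists, and
  either end may lie on a face. The slope \<open>c\<close> is an arbitrary number, not necessarily a
  derivative of \<open>C\<close>.\<close>

lemma section_linearization:
  assumes C: "is_copula C" and D: "has_continuous_partial_on C j {u \<in> unit_cube. 0 < u $ j \<and> u $ j < 1}"
    and v: "v \<in> unit_cube" and t: "0 \<le> t" "t \<le> 1"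
    and b: "\<And>r. 0 < r \<Longrightarrow> r < 1 \<Longrightarrow> \<bar>r - v $ j\<bar> \<le> \<bar>t - v $ j\<bar> \<Longrightarrow>
      \<bar>partial_deriv C j (\<chi> k. if k = j then r else v $ k) - c\<bar> \<le> b"
  shows "\<bar>section_at C j v t - C v - c * (t - v $ j)\<bar> \<le> b * \<bar>t - v $ j\<bar>"
proof -
  let ?f = "section_at C j v" and ?x = "v $ j"
  have x: "0 \<le> ?x" "?x \<le> 1" using v by (auto simp: unit_cube_def)
  have lip: "1-lipschitz_on {0..1} ?f"
    by (rule lipschitz_onI) (use copula_section_lipschitz[OF C v] in \<open>auto simp: dist_real_def\<close>)
  have mvt: "\<exists>r. p < r \<and> r < q \<and> ?f q - ?f p = (q - p) * partial_deriv C j (\<chi> k. if k = j then r else v $ k)"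
    if "p < q" "0 \<le> p" "q \<le> 1" for p q
  proof -
    have "continuous_on {p..q} ?f"
      using lipschitz_on_continuous_on[OF lip] that by (elim continuous_on_subset) auto
    moreover have "?f differentiable (at r)" if "p < r" "r < q" for r
      using section_has_partial_deriv[OF D v, of r] that \<open>0 \<le> p\<close> \<open>q \<le> 1\<close>
      by (auto simp: real_differentiable_def)
    ultimately obtain l r where r: "p < r" "r < q" "DERIV ?f r :> l" "?f q - ?f p = (q - p) * l"
      using MVT[OF \<open>p < q\<close>] by blast
    moreover have "l = partial_deriv C j (\<chi> k. if k = j then r else v $ k)"
      using DERIV_unique[OF r(3) section_has_partial_deriv[OF D v]] r that by auto
    ultimately show ?thesis by blast
  qed
  consider "t = ?x" | "?x < t" | "t < ?x" by linarith
  then show ?thesis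
  proof cases
    case 1
    then show ?thesis by (simp add: section_at_self)
  next
    case 2
    obtain r where r: "?x < r" "r < t"
      and eq: "?f t - ?f ?x = (t - ?x) * partial_deriv C j (\<chi> k. if k = j then r else v $ k)"
      using mvt[OF 2] x t by blast
    have "?f t - C v - c * (t - ?x) = (t - ?x) * (partial_deriv C j (\<chi> k. if k = j then r else v $ k) - c)"
      using eq by (simp add: section_at_self algebra_simps)
    then show ?thesis
      using b[of r] r x t 2 by (simp add: abs_mult mult.commute[of b] mult_left_mono)
  next
    case 3
    obtain r where r: "t < r" "r < ?x"
      and eq: "?f ?x - ?f t = (?x - t) * partial_deriv C j (\<chi> k. if k = j then r else v $ k)"
      using mvt[OF 3] x t by blast
    have "?f t - C v - c * (t - ?x) = (t - ?x) * (partial_deriv C j (\<chi> k. if k = j then r else v $ k) - c)"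
      using eq by (simp add: section_at_self algebra_simps)
    then show ?thesis
      using b[of r] r x t 3 by (simp add: abs_mult mult.commute[of b] mult_left_mono)
  qed
qed

text \<open>The path from \<open>u\<close> to \<open>w\<close> changes one coordinate at a time, and
  the one-dimensional expansions add up. The modulus combines a constant error \<open>e j\<close>
  with growth linear in the l1 distance; these give the first-order and the second-order part of the
  remainder.\<close>

lemma copula_linearization:
  fixes C :: "real ^ 'd \<Rightarrow> real"
  assumes C: "is_copula C" and D: "\<And>j. has_continuous_partial_on C j {u \<in> unit_cube. 0 < u $ j \<and> u $ j < 1}"
    and u: "u \<in> unit_cube" and w: "w \<in> unit_cube" and "0 \<le> K"
    and modulus: "\<And>j v. v \<in> unit_cube \<Longrightarrow> 0 < v $ j \<Longrightarrow> v $ j < 1 \<Longrightarrow>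
      \<bar>partial_deriv C j v - c j\<bar> \<le> e j + K * (\<Sum>k\<in>UNIV. \<bar>v $ k - u $ k\<bar>)"
  shows "\<bar>C w - C u - (\<Sum>j\<in>UNIV. c j * (w $ j - u $ j))\<bar>
    \<le> (\<Sum>j\<in>UNIV. e j * \<bar>w $ j - u $ j\<bar>) + K * (\<Sum>j\<in>UNIV. \<bar>w $ j - u $ j\<bar>)\<^sup>2"
proof -
  let ?D = "\<Sum>k\<in>UNIV. \<bar>w $ k - u $ k\<bar>"
  define mix where "mix A = (\<chi> k. if k \<in> A then w $ k else u $ k)" for A :: "'d set"
  have mix: "mix A \<in> unit_cube" for A using u w by (auto simp: mix_def unit_cube_def)
  have "\<bar>C (mix A) - C u - (\<Sum>j\<in>A. c j * (w $ j - u $ j))\<bar> \<le> (\<Sum>j\<in>A. (e j + K * ?D) * \<bar>w $ j - u $ j\<bar>)"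
    if "finite A" for A
    using that
  proof (induction A rule: finite_induct)
    case empty
    have "mix {} = u" by (simp add: mix_def vec_eq_iff)
    then show ?case by simp
  next
    case (insert j A)
    have j: "mix A $ j = u $ j" using insert by (simp add: mix_def)
    have new: "C (mix (insert j A)) = section_at C j (mix A) (w $ j)"
      unfolding section_at_def by (rule arg_cong[where f=C]) (simp add: mix_def vec_eq_iff)
    have "\<bar>section_at C j (mix A) (w $ j) - C (mix A) - c j * (w $ j - mix A $ j)\<bar>
        \<le> (e j + K * ?D) * \<bar>w $ j - mix A $ j\<bar>"
    proof (rule section_linearization[OF C D mix])
      fix r assume r: "0 < r" "r < 1" "\<bar>r - mix A $ j\<bar> \<le> \<bar>w $ j - mix A $ j\<bar>"
      let ?v = "\<chi> k. if k = j then r else mix A $ k"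
      have "\<bar>partial_deriv C j ?v - c j\<bar> \<le> e j + K * (\<Sum>k\<in>UNIV. \<bar>?v $ k - u $ k\<bar>)"
        by (rule modulus) (use r mix[of A] in \<open>auto intro!: unit_cube_update\<close>)
      \<comment> \<open>Along the path every coordinate is at most as far from \<open>u\<close> as
        that of \<open>w\<close>, so a single modulus bound serves all steps.\<close>
      also have "(\<Sum>k\<in>UNIV. \<bar>?v $ k - u $ k\<bar>) \<le> ?D"
        by (rule sum_mono) (use r j in \<open>auto simp: mix_def\<close>)
      finally show "\<bar>partial_deriv C j ?v - c j\<bar> \<le> e j + K * ?D"
        using \<open>0 \<le> K\<close> by (simp add: mult_left_mono)
    qed (use w in \<open>auto simp: unit_cube_def\<close>)
    then show ?case using insert unfolding new j by simp
  qed
  from this[of UNIV] have "\<bar>C w - C u - (\<Sum>j\<in>UNIV. c j * (w $ j - u $ j))\<bar>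
      \<le> (\<Sum>j\<in>UNIV. (e j + K * ?D) * \<bar>w $ j - u $ j\<bar>)"
    by (simp add: mix_def)
  also have "\<dots> = (\<Sum>j\<in>UNIV. e j * \<bar>w $ j - u $ j\<bar>) + K * ?D\<^sup>2"
    by (simp add: distrib_right sum.distrib power2_eq_square flip: sum_distrib_left mult.assoc)
  finally show ?thesis .
qed

subsection \<open>The bias of the Bernstein operator\<close>

text \<open>Averaging the expansion removes the linear part for any slopes \<open>c\<close>. The
  errors \<open>e j\<close> are paid at the scale of the standard deviation, the \<open>K\<close>
  part at the scale of the variance. One factor \<open>real CARD('d)\<close> comes from
  Cauchy-Schwarz for the squared l1 norm, the other from summing the variances.\<close>

lemma bernstein_bias:
  fixes C :: "real ^ 'd \<Rightarrow> real" and m :: "'d \<Rightarrow> nat"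
  assumes C: "is_copula C" and D: "\<And>j. has_continuous_partial_on C j {u \<in> unit_cube. 0 < u $ j \<and> u $ j < 1}"
    and u: "u \<in> unit_cube" and "0 \<le> K" and e: "\<And>j. 0 \<le> e j"
    and modulus: "\<And>j v. v \<in> unit_cube \<Longrightarrow> 0 < v $ j \<Longrightarrow> v $ j < 1 \<Longrightarrow>
      \<bar>partial_deriv C j v - c j\<bar> \<le> e j + K * (\<Sum>k\<in>UNIV. \<bar>v $ k - u $ k\<bar>)"
    and m: "1 \<le> \<mu>" "\<And>j. \<mu> \<le> m j"
  shows "\<bar>bernstein m C u - C u\<bar>
    \<le> (\<Sum>j\<in>UNIV. e j * sqrt (u $ j * (1 - u $ j) / real \<mu>)) + K * (real CARD('d))\<^sup>2 / real \<mu>"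
proof -
  let ?w = "\<lambda>s. weight m u s" and ?d = "\<lambda>s j. node m s $ j - u $ j"
  have mj: "1 \<le> m j" for j using m(1) m(2)[of j] by linarith
  have u01: "0 \<le> u $ j * (1 - u $ j)" for j using u by (simp add: unit_cube_def)
  have "(\<Sum>s\<in>grid m. ?w s * (\<Sum>j\<in>UNIV. c j * ?d s j)) = (\<Sum>s\<in>grid m. \<Sum>j\<in>UNIV. c j * (?w s * ?d s j))"
    by (simp add: sum_distrib_left algebra_simps)
  also have "\<dots> = (\<Sum>j\<in>UNIV. c j * (\<Sum>s\<in>grid m. ?w s * ?d s j))"
    by (subst sum.swap) (simp add: sum_distrib_left)
  also have "\<dots> = 0" using sum_weight_deviation[of m _ u, OF mj] by simp
  finally have linear: "(\<Sum>s\<in>grid m. ?w s * (\<Sum>j\<in>UNIV. c j * ?d s j)) = 0" .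
  have "bernstein m C u - C u = (\<Sum>s\<in>grid m. ?w s * (C (node m s) - C u))"
    by (simp add: bernstein_eq_weighted_sum right_diff_distrib sum_subtractf sum_weight flip: sum_distrib_right)
  also have "\<dots> = (\<Sum>s\<in>grid m. ?w s * (C (node m s) - C u - (\<Sum>j\<in>UNIV. c j * ?d s j)))"
    using linear by (simp add: right_diff_distrib sum_subtractf)
  finally have "\<bar>bernstein m C u - C u\<bar> = \<bar>\<dots>\<bar>" by simp
  also have "\<dots> \<le> (\<Sum>s\<in>grid m. ?w s * \<bar>C (node m s) - C u - (\<Sum>j\<in>UNIV. c j * ?d s j)\<bar>)"
    by (rule order_trans[OF sum_abs]) (simp add: abs_mult weight_nonneg[OF u])
  also have "\<dots> \<le> (\<Sum>s\<in>grid m. ?w s * ((\<Sum>j\<in>UNIV. e j * \<bar>?d s j\<bar>) + K * (real CARD('d) * (\<Sum>j\<in>UNIV. (?d s j)\<^sup>2))))"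
  proof (intro sum_mono mult_left_mono weight_nonneg[OF u])
    fix s assume "s \<in> grid m"
    have "(\<Sum>j\<in>UNIV. \<bar>?d s j\<bar>)\<^sup>2 \<le> real CARD('d) * (\<Sum>j\<in>UNIV. \<bar>?d s j\<bar>\<^sup>2)"
      using Cauchy_Schwarz_ineq_sum[of "\<lambda>_. 1" "\<lambda>j. \<bar>?d s j\<bar>" UNIV] by simp
    then have "K * (\<Sum>j\<in>UNIV. \<bar>?d s j\<bar>)\<^sup>2 \<le> K * (real CARD('d) * (\<Sum>j\<in>UNIV. (?d s j)\<^sup>2))"
      using \<open>0 \<le> K\<close> by (simp add: mult_left_mono)
    moreover have "\<bar>C (node m s) - C u - (\<Sum>j\<in>UNIV. c j * ?d s j)\<bar>
        \<le> (\<Sum>j\<in>UNIV. e j * \<bar>?d s j\<bar>) + K * (\<Sum>j\<in>UNIV. \<bar>?d s j\<bar>)\<^sup>2"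
      by (rule copula_linearization[OF C D u node_in_unit_cube[OF \<open>s \<in> grid m\<close>] \<open>0 \<le> K\<close> modulus])
    ultimately show "\<bar>C (node m s) - C u - (\<Sum>j\<in>UNIV. c j * ?d s j)\<bar>
        \<le> (\<Sum>j\<in>UNIV. e j * \<bar>?d s j\<bar>) + K * (real CARD('d) * (\<Sum>j\<in>UNIV. (?d s j)\<^sup>2))"
      by linarith
  qed
  also have "\<dots> = (\<Sum>s\<in>grid m. \<Sum>j\<in>UNIV. e j * (?w s * \<bar>?d s j\<bar>))
      + K * (real CARD('d) * (\<Sum>s\<in>grid m. \<Sum>j\<in>UNIV. ?w s * (?d s j)\<^sup>2))"
    unfolding distrib_left sum.distrib
    by (intro arg_cong2[where f="(+)"]) (simp_all add: sum_distrib_left mult.left_commute)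
  also have "\<dots> = (\<Sum>j\<in>UNIV. e j * (\<Sum>s\<in>grid m. ?w s * \<bar>?d s j\<bar>))
      + K * (real CARD('d) * (\<Sum>j\<in>UNIV. \<Sum>s\<in>grid m. ?w s * (?d s j)\<^sup>2))"
    by (subst sum.swap, subst (3) sum.swap) (simp add: sum_distrib_left)
  also have "\<dots> \<le> (\<Sum>j\<in>UNIV. e j * sqrt (u $ j * (1 - u $ j) / real \<mu>))
      + K * (real CARD('d) * (\<Sum>j\<in>(UNIV :: 'd set). 1 / real \<mu>))"
  proof (intro add_mono sum_mono mult_left_mono e \<open>0 \<le> K\<close>)
    fix j
    have frac: "u $ j * (1 - u $ j) / real (m j) \<le> u $ j * (1 - u $ j) / real \<mu>"
      using m(1) m(2)[of j] u01[of j] by (intro divide_left_mono) auto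
    then show "(\<Sum>s\<in>grid m. ?w s * \<bar>?d s j\<bar>) \<le> sqrt (u $ j * (1 - u $ j) / real \<mu>)"
      using sum_weight_abs_deviation[of m j, OF mj u] by (meson order_trans real_sqrt_le_mono)
    have "u $ j * (1 - u $ j) / real \<mu> \<le> 1 / real \<mu>"
      using variance_le_quarter[of "u $ j"] by (intro divide_right_mono) auto
    then show "(\<Sum>s\<in>grid m. ?w s * (?d s j)\<^sup>2) \<le> 1 / real \<mu>"
      using frac unfolding sum_weight_deviation_square[of m j, OF mj] by linarith
  qed simp
  also have "\<dots> = (\<Sum>j\<in>UNIV. e j * sqrt (u $ j * (1 - u $ j) / real \<mu>)) + K * (real CARD('d))\<^sup>2 / real \<mu>"
    by (simp add: power2_eq_square)
  finally show ?thesis .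
qed

section \<open>Moduli of the partial derivatives and the resulting bias rates\<close>

lemma compact_unit_cube: "compact (unit_cube :: (real ^ 'd) set)"
proof -
  have "unit_cube = cbox (0 :: real ^ 'd) 1"
    by (auto simp: unit_cube_def mem_box_cart)
  then show ?thesis by (metis compact_cbox)
qed

text \<open>Uniform continuity on a closed slab covers \<open>v\<close> close to \<open>u\<close>;
  for distant \<open>v\<close> the bound 2 on the difference is absorbed by the linear term. Hence
  \<open>v\<close> may come arbitrarily close to a face although \<open>f\<close> has no modulus
  there.\<close>

lemma continuous_interior_modulus:
  fixes f :: "real ^ 'd \<Rightarrow> real"
  assumes cont: "continuous_on {u \<in> unit_cube. 0 < u $ j \<and> u $ j < 1} f"
    and bound: "\<And>u. u \<in> unit_cube \<Longrightarrow> 0 < u $ j \<Longrightarrow> u $ j < 1 \<Longrightarrow> \<bar>f u\<bar> \<le> 1"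
    and "0 < \<delta>" "0 < e"
  shows "\<exists>K\<ge>0. \<forall>u v. u \<in> unit_cube \<longrightarrow> \<delta> \<le> u $ j \<longrightarrow> u $ j \<le> 1 - \<delta> \<longrightarrow>
      v \<in> unit_cube \<longrightarrow> 0 < v $ j \<longrightarrow> v $ j < 1 \<longrightarrow>
      \<bar>f v - f u\<bar> \<le> e + K * (\<Sum>k\<in>UNIV. \<bar>v $ k - u $ k\<bar>)"
proof -
  \<comment> \<open>Half the margin, so that points within \<open>\<delta> / 2\<close> of
    \<open>u\<close> remain in the slab.\<close>
  define T where "T = {u \<in> unit_cube. \<delta> / 2 \<le> u $ j \<and> u $ j \<le> 1 - \<delta> / 2}"
  have "closed {u :: real ^ 'd. \<delta> / 2 \<le> u $ j \<and> u $ j \<le> 1 - \<delta> / 2}"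
    by (intro closed_Collect_conj closed_Collect_le continuous_intros)
  then have "compact (unit_cube \<inter> {u :: real ^ 'd. \<delta> / 2 \<le> u $ j \<and> u $ j \<le> 1 - \<delta> / 2})"
    by (rule compact_Int_closed[OF compact_unit_cube])
  moreover have "T = unit_cube \<inter> {u. \<delta> / 2 \<le> u $ j \<and> u $ j \<le> 1 - \<delta> / 2}" by (auto simp: T_def)
  ultimately have "compact T" by simp
  moreover have "continuous_on T f"
    using cont by (rule continuous_on_subset) (use \<open>0 < \<delta>\<close> in \<open>auto simp: T_def\<close>)
  ultimately have "uniformly_continuous_on T f" by (rule compact_uniformly_continuous[rotated])
  then obtain \<eta> where \<eta>: "0 < \<eta>" "\<And>u v. u \<in> T \<Longrightarrow> v \<in> T \<Longrightarrow> dist v u < \<eta> \<Longrightarrow> dist (f v) (f u) < e"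
    using \<open>0 < e\<close> unfolding uniformly_continuous_on_def by metis
  \<comment> \<open>Closer than \<open>r\<close>, both points lie in \<open>T\<close> and uniform
    continuity applies; farther apart, \<open>2 / r\<close> times the distance is at least the
    trivial bound 2.\<close>
  define r where "r = min \<eta> (\<delta> / 2)"
  have "0 < r" using \<eta> \<open>0 < \<delta>\<close> by (simp add: r_def)
  show ?thesis
  proof (intro exI[of _ "2 / r"] conjI allI impI)
    fix u v :: "real ^ 'd"
    assume u: "u \<in> unit_cube" "\<delta> \<le> u $ j" "u $ j \<le> 1 - \<delta>" and v: "v \<in> unit_cube" "0 < v $ j" "v $ j < 1"
    let ?D = "\<Sum>k\<in>UNIV. \<bar>v $ k - u $ k\<bar>"
    have D: "0 \<le> ?D" by (simp add: sum_nonneg)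
    have dist: "dist v u \<le> ?D" using norm_le_l1_cart[of "v - u"] by (simp add: dist_norm)
    show "\<bar>f v - f u\<bar> \<le> e + 2 / r * ?D"
    proof (cases "?D < r")
      case True
      have "\<bar>v $ j - u $ j\<bar> \<le> dist v u" using component_le_norm_cart[of "v - u" j] by (simp add: dist_norm)
      then have "\<bar>v $ j - u $ j\<bar> < \<delta> / 2" using dist True by (simp add: r_def)
      then have "v $ j - u $ j < \<delta> / 2" "u $ j - v $ j < \<delta> / 2" by linarith+
      then have "v \<in> T" "u \<in> T" using u v \<open>0 < \<delta>\<close> by (auto simp: T_def)
      then have "dist (f v) (f u) < e" using \<eta>(2) dist True by (simp add: r_def)
      moreover have "0 \<le> 2 / r * ?D" using D \<open>0 < r\<close> by simp
      ultimately show ?thesis by (simp add: dist_real_def)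
    next
      case False
      then have "2 \<le> 2 / r * ?D" using \<open>0 < r\<close> by (simp add: field_simps)
      moreover have "\<bar>f v\<bar> \<le> 1" "\<bar>f u\<bar> \<le> 1" using bound[of v] bound[of u] u v \<open>0 < \<delta>\<close> by auto
      ultimately show ?thesis using \<open>0 < e\<close> by linarith
    qed
  qed (use \<open>0 < r\<close> in simp)
qed

text \<open>Each coordinate is treated on its own. At distance at least \<open>\<delta>\<close> from
  its faces the slope is the partial derivative at \<open>u\<close>, with error \<open>e'\<close>.
  Closer to a face the slope is 0 and the error 1, offset by a standard deviation of at most
  \<open>e' / sqrt \<mu>\<close>. The constant \<open>K\<close> depends on \<open>e\<close>, but
  neither on \<open>u\<close> nor on \<open>m\<close>.\<close>

lemma bernstein_bias_uniform:
  fixes C :: "real ^ 'd \<Rightarrow> real"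
  assumes C: "is_copula C" and D: "\<And>j. has_continuous_partial_on C j {u \<in> unit_cube. 0 < u $ j \<and> u $ j < 1}"
    and "0 < e"
  obtains K where "0 \<le> K" "\<And>(m :: 'd \<Rightarrow> nat) \<mu> (u :: real ^ 'd). u \<in> unit_cube \<Longrightarrow> 1 \<le> \<mu> \<Longrightarrow> (\<And>j. \<mu> \<le> m j) \<Longrightarrow>
    \<bar>bernstein m C u - C u\<bar> \<le> e / sqrt (real \<mu>) + K / real \<mu>"
proof -
  define e' where "e' = e / real CARD('d)"
  have "0 < e'" using \<open>0 < e\<close> by (simp add: e'_def)
  \<comment> \<open>With \<open>sqrt \<delta> = e'\<close>, coordinates near a face contribute no
    more than the bound for the inner ones.\<close>
  define \<delta> where "\<delta> = e'\<^sup>2"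
  have "0 < \<delta>" using \<open>0 < e'\<close> by (simp add: \<delta>_def)
  have "\<forall>j. \<exists>K\<ge>0. \<forall>u v. u \<in> unit_cube \<longrightarrow> \<delta> \<le> u $ j \<longrightarrow> u $ j \<le> 1 - \<delta> \<longrightarrow>
      v \<in> unit_cube \<longrightarrow> 0 < v $ j \<longrightarrow> v $ j < 1 \<longrightarrow>
      \<bar>partial_deriv C j v - partial_deriv C j u\<bar> \<le> e' + K * (\<Sum>k\<in>UNIV. \<bar>v $ k - u $ k\<bar>)"
  proof (intro allI continuous_interior_modulus)
    show "continuous_on {u \<in> unit_cube. 0 < u $ j \<and> u $ j < 1} (partial_deriv C j)" for j
      using D[of j] by (simp add: has_continuous_partial_on_def)
  qed (fact abs_partial_deriv_copula_le[OF C D] \<open>0 < \<delta>\<close> \<open>0 < e'\<close>)+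
  from choice[OF this] obtain k where k0: "\<And>j. 0 \<le> k j" and
    k: "\<And>j u v. u \<in> unit_cube \<Longrightarrow> \<delta> \<le> u $ j \<Longrightarrow> u $ j \<le> 1 - \<delta> \<Longrightarrow>
      v \<in> unit_cube \<Longrightarrow> 0 < v $ j \<Longrightarrow> v $ j < 1 \<Longrightarrow>
      \<bar>partial_deriv C j v - partial_deriv C j u\<bar> \<le> e' + k j * (\<Sum>k\<in>UNIV. \<bar>v $ k - u $ k\<bar>)"
    by blast
  define K where "K = (\<Sum>j\<in>UNIV. k j)"
  have K: "k j \<le> K" for j unfolding K_def using k0 by (intro member_le_sum) auto
  have "0 \<le> K" unfolding K_def using k0 by (simp add: sum_nonneg)
  show thesis
  proof (rule that[of "K * (real CARD('d))\<^sup>2"])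
    fix m :: "'d \<Rightarrow> nat" and \<mu> and u :: "real ^ 'd"
    assume u: "u \<in> unit_cube" and \<mu>: "1 \<le> \<mu>" "\<And>j. \<mu> \<le> m j"
    define inner where "inner j \<longleftrightarrow> \<delta> \<le> u $ j \<and> u $ j \<le> 1 - \<delta>" for j
    have "\<bar>bernstein m C u - C u\<bar>
        \<le> (\<Sum>j\<in>UNIV. (if inner j then e' else 1) * sqrt (u $ j * (1 - u $ j) / real \<mu>))
          + K * (real CARD('d))\<^sup>2 / real \<mu>"
    proof (rule bernstein_bias[OF C D u \<open>0 \<le> K\<close> _ _ \<mu>])
      fix j and v :: "real ^ 'd" assume v: "v \<in> unit_cube" "0 < v $ j" "v $ j < 1"
      let ?D = "\<Sum>k\<in>UNIV. \<bar>v $ k - u $ k\<bar>"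
      have "0 \<le> ?D" by (simp add: sum_nonneg)
      then have KD: "k j * ?D \<le> K * ?D" "0 \<le> K * ?D" using K \<open>0 \<le> K\<close> by (auto simp: mult_right_mono)
      show "\<bar>partial_deriv C j v - (if inner j then partial_deriv C j u else 0)\<bar>
          \<le> (if inner j then e' else 1) + K * ?D"
      proof (cases "inner j")
        case True
        then show ?thesis using k[OF u _ _ v] KD(1) unfolding inner_def by fastforce
      next
        case False
        then show ?thesis using abs_partial_deriv_copula_le[OF C D v] KD(2) by simp
      qed
    qed (use \<open>0 < e'\<close> in auto)
    also have "(\<Sum>j\<in>UNIV. (if inner j then e' else 1) * sqrt (u $ j * (1 - u $ j) / real \<mu>))
        \<le> (\<Sum>j\<in>(UNIV :: 'd set). e' / sqrt (real \<mu>))"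
    proof (rule sum_mono)
      fix j
      have u01: "0 \<le> u $ j" "u $ j \<le> 1" using u by (auto simp: unit_cube_def)
      show "(if inner j then e' else 1) * sqrt (u $ j * (1 - u $ j) / real \<mu>) \<le> e' / sqrt (real \<mu>)"
      proof (cases "inner j")
        case True
        have "u $ j * (1 - u $ j) \<le> 1" using variance_le_quarter[of "u $ j"] by linarith
        then have "sqrt (u $ j * (1 - u $ j)) \<le> 1" by simp
        then have "e' * sqrt (u $ j * (1 - u $ j)) / sqrt (real \<mu>) \<le> e' * 1 / sqrt (real \<mu>)"
          using \<open>0 < e'\<close> by (intro divide_right_mono mult_left_mono) auto
        then show ?thesis using True by (simp add: real_sqrt_divide)
      next
        case False
        have "u $ j * (1 - u $ j) \<le> \<delta>"
        proof (cases "u $ j < \<delta>")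
          case True
          have "u $ j * (1 - u $ j) \<le> u $ j * 1" using u01 by (intro mult_left_mono) auto
          then show ?thesis using True by linarith
        next
          case nless: False
          have "u $ j * (1 - u $ j) \<le> 1 * (1 - u $ j)" using u01 by (intro mult_right_mono) auto
          then show ?thesis using nless False by (simp add: inner_def)
        qed
        then have "sqrt (u $ j * (1 - u $ j)) \<le> sqrt \<delta>" by simp
        also have "sqrt \<delta> = e'" using \<open>0 < e'\<close> by (simp add: \<delta>_def)
        finally show ?thesis using False by (simp add: real_sqrt_divide divide_right_mono)
      qed
    qed
    also have "\<dots> = e / sqrt (real \<mu>)" by (simp add: e'_def)
    finally show "\<bar>bernstein m C u - C u\<bar> \<le> e / sqrt (real \<mu>) + K * (real CARD('d))\<^sup>2 / real \<mu>" by simp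
  qed (use \<open>0 \<le> K\<close> in simp)
qed

text \<open>For \<open>u $ j < 1\<close> the constant error is 0: near \<open>u\<close> the
  Lipschitz bound applies, and elsewhere the trivial bound 2 is at most
  \<open>2 / \<epsilon>\<close> times the distance. For \<open>u $ j = 1\<close> the binomial
  variance is 0, so an error of 1 costs nothing. No first-order term is left, hence the rate
  \<open>1 / \<mu>\<close> in place of \<open>1 / sqrt \<mu>\<close>.\<close>

lemma bernstein_bias_pointwise:
  fixes C :: "real ^ 'd \<Rightarrow> real"
  assumes C: "is_copula C" and D: "\<And>j. has_continuous_partial_on C j {u \<in> unit_cube. 0 < u $ j \<and> u $ j < 1}"
    and u: "\<And>j. 0 < u $ j \<and> u $ j \<le> 1" and "0 < \<epsilon>"
    and lip: "\<And>j. u $ j < 1 \<Longrightarrow> \<exists>K. K-lipschitz_on {w \<in> unit_cube. infnorm (w - u) \<le> \<epsilon>} (partial_deriv C j)"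
  obtains K where "0 \<le> K" "\<And>(m :: 'd \<Rightarrow> nat) \<mu>. 1 \<le> \<mu> \<Longrightarrow> (\<And>j. \<mu> \<le> m j) \<Longrightarrow>
    \<bar>bernstein m C u - C u\<bar> \<le> K / real \<mu>"
proof -
  have cube: "u \<in> unit_cube" using u by (simp add: unit_cube_def less_imp_le)
  have "\<forall>j. \<exists>K. 0 \<le> K \<and> (u $ j < 1 \<longrightarrow> K-lipschitz_on {w \<in> unit_cube. infnorm (w - u) \<le> \<epsilon>} (partial_deriv C j))"
  proof
    fix j
    show "\<exists>K. 0 \<le> K \<and> (u $ j < 1 \<longrightarrow> K-lipschitz_on {w \<in> unit_cube. infnorm (w - u) \<le> \<epsilon>} (partial_deriv C j))"
      using lip[of j] lipschitz_on_nonneg by (cases "u $ j < 1") auto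
  qed
  from choice[OF this] obtain k where k0: "\<And>j. 0 \<le> k j" and
    k: "\<And>j. u $ j < 1 \<Longrightarrow> (k j)-lipschitz_on {w \<in> unit_cube. infnorm (w - u) \<le> \<epsilon>} (partial_deriv C j)"
    by blast
  define K where "K = (\<Sum>j\<in>UNIV. k j) + 2 / \<epsilon>"
  have "k j \<le> (\<Sum>j\<in>UNIV. k j)" for j using k0 by (intro member_le_sum) auto
  moreover have "0 \<le> (\<Sum>j\<in>UNIV. k j)" using k0 by (simp add: sum_nonneg)
  ultimately have K: "k j \<le> K" "2 / \<epsilon> \<le> K" "0 \<le> K" for j
    using \<open>0 < \<epsilon>\<close> unfolding K_def by (auto intro: add_increasing2 add_nonneg_nonneg)
  show thesis
  proof (rule that[of "K * (real CARD('d))\<^sup>2"])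
    fix m :: "'d \<Rightarrow> nat" and \<mu>
    assume \<mu>: "1 \<le> \<mu>" "\<And>j. \<mu> \<le> m j"
    have "\<bar>bernstein m C u - C u\<bar>
        \<le> (\<Sum>j\<in>UNIV. (if u $ j < 1 then 0 else 1) * sqrt (u $ j * (1 - u $ j) / real \<mu>))
          + K * (real CARD('d))\<^sup>2 / real \<mu>"
    proof (rule bernstein_bias[OF C D cube K(3) _ _ \<mu>])
      fix j and v :: "real ^ 'd" assume v: "v \<in> unit_cube" "0 < v $ j" "v $ j < 1"
      let ?D = "\<Sum>k\<in>UNIV. \<bar>v $ k - u $ k\<bar>"
      have D0: "0 \<le> ?D" by (simp add: sum_nonneg)
      have dist: "dist v u \<le> ?D" using norm_le_l1_cart[of "v - u"] by (simp add: dist_norm)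
      show "\<bar>partial_deriv C j v - (if u $ j < 1 then partial_deriv C j u else 0)\<bar>
          \<le> (if u $ j < 1 then 0 else 1) + K * ?D"
      proof (cases "u $ j < 1")
        case True
        have "\<bar>partial_deriv C j v - partial_deriv C j u\<bar> \<le> K * ?D"
        proof (cases "infnorm (v - u) \<le> \<epsilon>")
          case near: True
          have "dist (partial_deriv C j v) (partial_deriv C j u) \<le> k j * dist v u"
            by (rule lipschitz_onD[OF k[OF True]]) (use near v cube \<open>0 < \<epsilon>\<close> in \<open>auto simp: infnorm_0\<close>)
          also have "\<dots> \<le> K * ?D" using K k0 D0 dist by (intro mult_mono) auto
          finally show ?thesis by (simp add: dist_real_def)
        next
          case False
          then have "\<epsilon> \<le> ?D" using infnorm_le_norm[of "v - u"] dist by (simp add: dist_norm)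
          then have "2 \<le> 2 / \<epsilon> * ?D" using \<open>0 < \<epsilon>\<close> by (simp add: field_simps)
          also have "\<dots> \<le> K * ?D" by (rule mult_right_mono[OF K(2) D0])
          finally show ?thesis
            using abs_partial_deriv_copula_le[OF C D v] abs_partial_deriv_copula_le[OF C D cube, of j] u[of j] True
            by linarith
        qed
        then show ?thesis using True by simp
      next
        case False
        then show ?thesis
          using abs_partial_deriv_copula_le[OF C D v] mult_nonneg_nonneg[OF K(3) D0] by simp
      qed
    qed simp
    also have "(\<Sum>j\<in>UNIV. (if u $ j < 1 then 0 else 1) * sqrt (u $ j * (1 - u $ j) / real \<mu>)) = 0"
    proof (intro sum.neutral ballI)
      fix j show "(if u $ j < 1 then 0 else 1) * sqrt (u $ j * (1 - u $ j) / real \<mu>) = 0"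
        using u[of j] by (cases "u $ j = 1") auto
    qed
    finally show "\<bar>bernstein m C u - C u\<bar> \<le> K * (real CARD('d))\<^sup>2 / real \<mu>" by simp
  qed (use K(3) in simp)
qed

subsection \<open>Asymptotic equicontinuity\<close>

lemma mspace_l_infty: "mspace (l_infty T) = {f \<in> extensional T. bounded (f ` T)}"
  by (auto simp: l_infty_def Met_TC.fspace_def)

lemma mdist_l_infty:
  assumes "f \<in> mspace (l_infty T)" "g \<in> mspace (l_infty T)" "T \<noteq> {}"
  shows "mdist (l_infty T) f g = (SUP x\<in>T. \<bar>f x - g x\<bar>)"
  using assms by (auto simp: l_infty_def Met_TC.fdist_def dist_real_def)

lemma abs_diff_le_mdist_l_infty:
  assumes "f \<in> mspace (l_infty T)" "g \<in> mspace (l_infty T)" "x \<in> T"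
  shows "\<bar>f x - g x\<bar> \<le> mdist (l_infty T) f g"
proof -
  have "bdd_above ((\<lambda>x. dist (f x) (g x)) ` T)"
    by (rule Met_TC.bdd_above_dist) (use assms in \<open>auto simp: l_infty_def\<close>)
  then show ?thesis
    using assms by (subst mdist_l_infty) (auto simp: dist_real_def intro: cSUP_upper)
qed

text \<open>Takes the place of the modulus of continuity; it vanishes on \<open>k\<close>-Lipschitz functions.\<close>

definition lip_excess :: "real \<Rightarrow> (real ^ 'd \<Rightarrow> real) \<Rightarrow> real" where
  "lip_excess k g = (SUP p\<in>unit_cube \<times> unit_cube. \<bar>g (fst p) - g (snd p)\<bar> - k * dist (fst p) (snd p))"

lemma zero_in_unit_cube: "0 \<in> unit_cube"
  by (simp add: unit_cube_def)

lemma abs_diff_le_lip_excess: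
  assumes "g \<in> mspace (l_infty unit_cube)" "0 \<le> k" "w \<in> unit_cube" "u \<in> unit_cube"
  shows "\<bar>g w - g u\<bar> \<le> lip_excess k g + k * dist w u"
proof -
  obtain B where B: "\<And>v. v \<in> unit_cube \<Longrightarrow> \<bar>g v\<bar> \<le> B"
    using assms(1) by (auto simp: mspace_l_infty bounded_iff)
  have "bdd_above ((\<lambda>p. \<bar>g (fst p) - g (snd p)\<bar> - k * dist (fst p) (snd p)) ` (unit_cube \<times> unit_cube))"
  proof (rule bdd_aboveI2)
    fix p :: "(real ^ 'a) \<times> (real ^ 'a)" assume p: "p \<in> unit_cube \<times> unit_cube"
    have "0 \<le> k * dist (fst p) (snd p)" using assms(2) by simp
    then show "\<bar>g (fst p) - g (snd p)\<bar> - k * dist (fst p) (snd p) \<le> 2 * B"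
      using B[of "fst p"] B[of "snd p"] p by (auto simp: mem_Times_iff)
  qed
  from cSUP_upper[OF _ this, of "(w, u)"] show ?thesis using assms by (simp add: lip_excess_def)
qed

lemma lip_excess_nonneg:
  assumes "g \<in> mspace (l_infty unit_cube)" "0 \<le> k"
  shows "0 \<le> lip_excess k g"
  using abs_diff_le_lip_excess[OF assms zero_in_unit_cube zero_in_unit_cube] by simp

lemma lip_excess_le:
  fixes g :: "real ^ 'd \<Rightarrow> real"
  assumes "\<And>u w. u \<in> unit_cube \<Longrightarrow> w \<in> unit_cube \<Longrightarrow> \<bar>g w - g u\<bar> \<le> c + k * dist w u"
  shows "lip_excess k g \<le> c"
  unfolding lip_excess_def
proof (rule cSUP_least)
  fix p :: "(real ^ 'd) \<times> (real ^ 'd)" assume "p \<in> unit_cube \<times> unit_cube"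
  then show "\<bar>g (fst p) - g (snd p)\<bar> - k * dist (fst p) (snd p) \<le> c"
    using assms[of "snd p" "fst p"] by (auto simp: mem_Times_iff)
qed (use zero_in_unit_cube in blast)

text \<open>Replacing \<open>f\<close> by \<open>g\<close> alters the values at both points of a
  pair by at most the supremum distance, hence the factor 2. This continuity is what makes the
  excess, once truncated, a test function for weak convergence.\<close>

lemma lip_excess_lipschitz:
  assumes f: "f \<in> mspace (l_infty unit_cube)" and g: "g \<in> mspace (l_infty unit_cube)" and "0 \<le> k"
  shows "\<bar>lip_excess k f - lip_excess k g\<bar> \<le> 2 * mdist (l_infty unit_cube) f g"
proof -
  have "lip_excess k f \<le> lip_excess k g + 2 * mdist (l_infty unit_cube) f g"
    if fg: "f \<in> mspace (l_infty unit_cube)" "g \<in> mspace (l_infty unit_cube)" for f g :: "real ^ 'a \<Rightarrow> real"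
  proof (rule lip_excess_le)
    fix u w :: "real ^ 'a" assume uw: "u \<in> unit_cube" "w \<in> unit_cube"
    show "\<bar>f w - f u\<bar> \<le> lip_excess k g + 2 * mdist (l_infty unit_cube) f g + k * dist w u"
      using abs_diff_le_lip_excess[OF fg(2) \<open>0 \<le> k\<close> uw(2,1)]
        abs_diff_le_mdist_l_infty[OF fg uw(1)] abs_diff_le_mdist_l_infty[OF fg uw(2)] by linarith
  qed
  from this[OF f g] this[OF g f] show ?thesis by (simp add: mdist_commute abs_le_iff)
qed

lemma lip_excess_tendsto_0:
  assumes g: "g \<in> mspace (l_infty unit_cube)" and cont: "continuous_on unit_cube g"
  shows "(\<lambda>k. lip_excess (real k) g) \<longlonglongrightarrow> 0"
proof (rule LIMSEQ_I)
  fix e :: real assume "0 < e"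
  obtain B where B: "\<And>v. v \<in> unit_cube \<Longrightarrow> \<bar>g v\<bar> \<le> B"
    using g by (auto simp: mspace_l_infty bounded_iff)
  have "uniformly_continuous_on unit_cube g"
    by (rule compact_uniformly_continuous[OF cont compact_unit_cube])
  then obtain d where d: "0 < d" "\<And>u w. u \<in> unit_cube \<Longrightarrow> w \<in> unit_cube \<Longrightarrow> dist w u < d \<Longrightarrow> dist (g w) (g u) < e / 2"
    using half_gt_zero[OF \<open>0 < e\<close>] unfolding uniformly_continuous_on_def by blast
  \<comment> \<open>Pairs at distance at least \<open>d\<close> contribute at most
    \<open>2 * B - real k * d\<close>, which is not positive from \<open>k0\<close> on; closer pairs
    contribute less than \<open>e / 2\<close>.\<close>
  obtain k0 :: nat where k0: "2 * B / d \<le> real k0" using real_arch_simple by blast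
  have "norm (lip_excess (real k) g - 0) < e" if "k0 \<le> k" for k
  proof -
    have "lip_excess (real k) g \<le> e / 2"
    proof (rule lip_excess_le)
      fix u w :: "real ^ 'a" assume uw: "u \<in> unit_cube" "w \<in> unit_cube"
      show "\<bar>g w - g u\<bar> \<le> e / 2 + real k * dist w u"
      proof (cases "dist w u < d")
        case True
        have "0 \<le> real k * dist w u" by simp
        then show ?thesis using d(2)[OF uw True] unfolding dist_real_def by linarith
      next
        case False
        have "2 * B \<le> real k0 * d" using k0 d by (simp add: field_simps)
        also have "\<dots> \<le> real k * dist w u" using False that d by (intro mult_mono) auto
        finally show ?thesis using B[OF uw(1)] B[OF uw(2)] \<open>0 < e\<close> by linarith
      qed
    qed
    then show ?thesis using lip_excess_nonneg[OF g, of "real k"] \<open>0 < e\<close> by simp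
  qed
  then show "\<exists>k0. \<forall>k\<ge>k0. norm (lip_excess (real k) g - 0) < e" by blast
qed

text \<open>The domination of \<open>Z\<close> holds for every slope \<open>k\<close>, from an index
  on that may depend on \<open>k\<close> and \<open>\<delta>\<close>. So \<open>k\<close> can be
  chosen first, making the truncated excess of \<open>L\<close> small in mean; weak convergence
  carries this over to the outer expectations of \<open>Y n\<close>, and Markov's inequality
  concludes.\<close>

lemma is_oP1_lip_excess:
  fixes Y :: "nat \<Rightarrow> 'a \<Rightarrow> real ^ 'd \<Rightarrow> real"
  assumes "prob_space M" "prob_space N"
    and weak: "converges_weakly (l_infty unit_cube) M Y N L"
    and cont: "AE \<omega> in N. continuous_on unit_cube (L \<omega>)"
    and Z: "\<And>k \<delta>. 0 < \<delta> \<Longrightarrow>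
      eventually (\<lambda>n. \<forall>\<omega>\<in>space M. \<bar>Z n \<omega>\<bar> \<le> lip_excess (real k) (Y n \<omega>) + \<delta>) sequentially"
  shows "is_oP1 M Z"
  unfolding is_oP1_def
proof (intro allI impI order_tendstoI)
  interpret M: prob_space M by fact
  interpret N: prob_space N by fact
  fix \<delta> :: real and a :: ennreal assume "0 < \<delta>" "0 < a"
  \<comment> \<open>The bound \<open>a\<close> may be infinite, while Markov's inequality needs a
    positive real below it.\<close>
  obtain \<eta>' where \<eta>': "0 < \<eta>'" "\<eta>' < a" using dense[OF \<open>0 < a\<close>] by blast
  then obtain \<eta> where \<eta>: "0 < \<eta>" "ennreal \<eta> < a"
    by (cases \<eta>') (auto simp: ennreal_less_zero_iff top_unique)
  have Y: "Y n \<omega> \<in> mspace (l_infty unit_cube)" if "\<omega> \<in> space M" for n \<omega>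
    using weak that unfolding converges_weakly_def by blast
  have L: "L \<in> measurable N (borel_of_metric (l_infty unit_cube))"
    using weak unfolding converges_weakly_def by blast
  have Lsp: "L \<omega> \<in> mspace (l_infty unit_cube)" if "\<omega> \<in> space N" for \<omega>
    using measurable_space[OF L that] by simp
  \<comment> \<open>Half of \<open>\<delta>\<close> is reserved for the remainder in the bound on
    \<open>Z\<close>; the cap 1 fits the truncated test function.\<close>
  define c where "c = min 1 (\<delta> / 2)"
  have c: "0 < c" "c \<le> 1" "c \<le> \<delta> / 2" using \<open>0 < \<delta>\<close> by (auto simp: c_def)
  let ?h = "\<lambda>k (g :: real ^ 'd \<Rightarrow> real). min 1 (lip_excess (real k) g)"
  have cm: "continuous_map (mtopology_of (l_infty unit_cube)) euclideanreal (?h k)" for k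
  proof (rule continuous_map_lipschitz)
    fix f g :: "real ^ 'd \<Rightarrow> real"
    assume "f \<in> mspace (l_infty unit_cube)" "g \<in> mspace (l_infty unit_cube)"
    then have "\<bar>lip_excess (real k) f - lip_excess (real k) g\<bar> \<le> 2 * mdist (l_infty unit_cube) f g"
      by (rule lip_excess_lipschitz) simp
    then show "\<bar>?h k f - ?h k g\<bar> \<le> 2 * mdist (l_infty unit_cube) f g" by linarith
  qed
  have h01: "\<bar>?h k g\<bar> \<le> 1" if "g \<in> mspace (l_infty unit_cube)" for k g
    using lip_excess_nonneg[OF that, of "real k"] by simp
  have "(\<lambda>k. \<integral>\<omega>. ?h k (L \<omega>) \<partial>N) \<longlonglongrightarrow> (\<integral>\<omega>. 0 \<partial>N)"
  proof (rule integral_dominated_convergence[where w="\<lambda>_. 1"])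
    show "(\<lambda>\<omega>. ?h k (L \<omega>)) \<in> borel_measurable N" for k
      using measurable_compose[OF L borel_measurable_continuous_map[OF cm]] .
    show "AE \<omega> in N. norm (?h k (L \<omega>)) \<le> 1" for k
      using h01[OF Lsp] by (intro AE_I2) simp
    show "AE \<omega> in N. (\<lambda>k. ?h k (L \<omega>)) \<longlonglongrightarrow> 0"
      using cont
    proof (rule AE_mp, intro AE_I2 impI)
      fix \<omega> assume "\<omega> \<in> space N" "continuous_on unit_cube (L \<omega>)"
      from tendsto_min[OF tendsto_const lip_excess_tendsto_0[OF Lsp this(2)], OF this(1), of 1]
      show "(\<lambda>k. ?h k (L \<omega>)) \<longlonglongrightarrow> 0" by simp
    qed
  qed simp_all
  then have "eventually (\<lambda>k. (\<integral>\<omega>. ?h k (L \<omega>) \<partial>N) < c * \<eta>) sequentially"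
    using c \<eta> by (intro order_tendstoD(2)) auto
  then obtain k where k: "(\<integral>\<omega>. ?h k (L \<omega>) \<partial>N) < c * \<eta>"
    unfolding eventually_sequentially by blast
  have "bounded (?h k ` mspace (l_infty unit_cube))"
    using h01 by (auto simp: bounded_iff)
  then have "(\<lambda>n. outer_expectation M (\<lambda>\<omega>. ?h k (Y n \<omega>))) \<longlonglongrightarrow> (\<integral>\<omega>. ?h k (L \<omega>) \<partial>N)"
    using weak cm[of k] unfolding converges_weakly_def by blast
  then have "eventually (\<lambda>n. outer_expectation M (\<lambda>\<omega>. ?h k (Y n \<omega>)) < c * \<eta>) sequentially"
    using k by (rule order_tendstoD(2))
  moreover have "eventually (\<lambda>n. \<forall>\<omega>\<in>space M. \<bar>Z n \<omega>\<bar> \<le> lip_excess (real k) (Y n \<omega>) + \<delta> / 2) sequentially"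
    using \<open>0 < \<delta>\<close> by (intro Z) simp
  ultimately show "eventually (\<lambda>n. outer_measure_of M {\<omega> \<in> space M. \<bar>Z n \<omega>\<bar> > \<delta>} < a) sequentially"
  proof eventually_elim
    case (elim n)
    have "{\<omega> \<in> space M. \<bar>Z n \<omega>\<bar> > \<delta>} \<subseteq> {\<omega> \<in> space M. c \<le> lip_excess (real k) (Y n \<omega>)}"
    proof (intro Collect_mono impI)
      fix \<omega> assume "\<omega> \<in> space M \<and> \<bar>Z n \<omega>\<bar> > \<delta>"
      with bspec[OF elim(2), of \<omega>] c(3) show "\<omega> \<in> space M \<and> c \<le> lip_excess (real k) (Y n \<omega>)" by auto
    qed
    then have "outer_measure_of M {\<omega> \<in> space M. \<bar>Z n \<omega>\<bar> > \<delta>}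
        \<le> outer_measure_of M {\<omega> \<in> space M. c \<le> lip_excess (real k) (Y n \<omega>)}"
      by (rule outer_measure_of_mono)
    also have "\<dots> \<le> ennreal \<eta>"
      by (rule M.outer_measure_of_markov[OF c(1,2) \<eta>(1) _ elim(1)]) (simp add: lip_excess_nonneg Y)
    finally show ?case using \<eta>(2) by (rule le_less_trans)
  qed
qed simp

subsection \<open>The empirical Bernstein copula process\<close>

lemma abs_empirical_copula_le: "\<bar>empirical_copula x n u\<bar> \<le> 1"
proof -
  let ?p = "\<lambda>i. \<Prod>j\<in>UNIV. of_bool (real (sample_rank x n i j) / real n \<le> u $ j) :: real"
  have "\<bar>\<Sum>i=1..n. ?p i\<bar> \<le> (\<Sum>i=1..n. 1)"
    by (rule order_trans[OF sum_abs sum_mono]) (auto simp: abs_prod intro!: prod_le_1)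
  \<comment> \<open>For \<open>n = 0\<close> the quotient \<open>1 / real n\<close> is 0, and so is
    the empirical copula.\<close>
  then show ?thesis by (cases "n = 0") (simp_all add: empirical_copula_def abs_mult field_simps)
qed

lemma abs_copula_le:
  assumes "is_copula C" "u \<in> unit_cube"
  shows "\<bar>C u\<bar> \<le> 1"
  using assms prob_space.prob_le_1 by (auto simp: is_copula_def joint_cdf_def)

lemma abs_bernstein_le:
  assumes "\<And>v. v \<in> unit_cube \<Longrightarrow> \<bar>f v\<bar> \<le> 1" "u \<in> unit_cube"
  shows "\<bar>bernstein m f u\<bar> \<le> 1"
proof -
  have "\<bar>bernstein m f u\<bar> \<le> (\<Sum>s\<in>grid m. weight m u s * 1)"
    unfolding bernstein_eq_weighted_sum
  proof (rule order_trans[OF sum_abs sum_mono])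
    fix s assume "s \<in> grid m"
    then show "\<bar>weight m u s * f (node m s)\<bar> \<le> weight m u s * 1"
      unfolding abs_mult abs_of_nonneg[OF weight_nonneg[OF assms(2)]]
      by (intro mult_left_mono assms(1) node_in_unit_cube weight_nonneg assms(2))
  qed
  then show ?thesis by (simp add: sum_weight)
qed

text \<open>Weak convergence demands membership at every index, including \<open>n = 0\<close>,
  where entries of \<open>m\<close> may vanish. The bound survives this: a quotient by 0 is 0, so
  the nodes stay in the cube, and the weights still sum to 1.\<close>

lemma emp_bernstein_process_in_l_infty:
  assumes "is_copula C"
  shows "emp_bernstein_process C x n m \<in> mspace (l_infty unit_cube)"
proof -
  have "\<bar>emp_bernstein_process C x n m u\<bar> \<le> sqrt (real n) * 2" if "u \<in> unit_cube" for u
  proof -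
    have "\<bar>bernstein m (empirical_copula x n) u - C u\<bar> \<le> 2"
      using abs_bernstein_le[of "empirical_copula x n" u m, OF abs_empirical_copula_le that]
        abs_copula_le[OF assms that] by linarith
    then show ?thesis
      using that by (simp add: emp_bernstein_process_def abs_mult mult_left_mono)
  qed
  then have "bounded (emp_bernstein_process C x n m ` unit_cube)" by (auto simp: bounded_iff)
  moreover have "emp_bernstein_process C x n m \<in> extensional unit_cube"
    by (simp add: emp_bernstein_process_def)
  ultimately show ?thesis by (simp add: mspace_l_infty)
qed

lemma sum_weight_dist:
  fixes u :: "real ^ 'd"
  assumes u: "u \<in> unit_cube" and m: "1 \<le> \<mu>" "\<And>j. \<mu> \<le> m j"
  shows "(\<Sum>s\<in>grid m. weight m u s * dist (node m s) u) \<le> real CARD('d) / sqrt (real \<mu>)"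
proof -
  have "(\<Sum>s\<in>grid m. weight m u s * dist (node m s) u)
      \<le> (\<Sum>s\<in>grid m. weight m u s * (\<Sum>j\<in>UNIV. \<bar>node m s $ j - u $ j\<bar>))"
  proof (intro sum_mono mult_left_mono weight_nonneg[OF u])
    show "dist (node m s) u \<le> (\<Sum>j\<in>UNIV. \<bar>node m s $ j - u $ j\<bar>)" for s
      using norm_le_l1_cart[of "node m s - u"] by (simp add: dist_norm)
  qed
  also have "\<dots> = (\<Sum>j\<in>UNIV. \<Sum>s\<in>grid m. weight m u s * \<bar>node m s $ j - u $ j\<bar>)"
    unfolding sum_distrib_left by (rule sum.swap)
  also have "\<dots> \<le> (\<Sum>j\<in>(UNIV :: 'd set). 1 / sqrt (real \<mu>))"
  proof (rule sum_mono)
    fix j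
    have mj: "1 \<le> m j" using m(1) m(2)[of j] by linarith
    have "(\<Sum>s\<in>grid m. weight m u s * \<bar>node m s $ j - u $ j\<bar>) \<le> sqrt (u $ j * (1 - u $ j) / real (m j))"
      by (rule sum_weight_abs_deviation[of m j u, OF mj u])
    also have "\<dots> \<le> sqrt (1 / real \<mu>)"
      using variance_le_quarter[of "u $ j"] m(1) m(2)[of j]
      by (intro real_sqrt_le_mono frac_le) auto
    finally show "(\<Sum>s\<in>grid m. weight m u s * \<bar>node m s $ j - u $ j\<bar>) \<le> 1 / sqrt (real \<mu>)"
      by (simp add: real_sqrt_divide)
  qed
  finally show ?thesis by simp
qed

text \<open>Averaging \<open>abs_diff_le_lip_excess\<close> over the nodes leaves the excess
  unchanged, as the weights sum to 1, and turns the distance into its mean. For fixed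
  \<open>k\<close> the middle term vanishes as \<open>\<mu>\<close> grows.\<close>

lemma emp_bernstein_process_diff:
  fixes C :: "real ^ 'd \<Rightarrow> real" and m :: "'d \<Rightarrow> nat"
  assumes g: "emp_process C x n \<in> mspace (l_infty unit_cube)" and u: "u \<in> unit_cube" and "0 \<le> k"
    and m: "1 \<le> \<mu>" "\<And>j. \<mu> \<le> m j"
  shows "\<bar>emp_bernstein_process C x n m u - emp_process C x n u\<bar>
    \<le> lip_excess k (emp_process C x n) + k * real CARD('d) / sqrt (real \<mu>)
      + sqrt (real n) * \<bar>bernstein m C u - C u\<bar>"
proof -
  let ?g = "emp_process C x n" and ?w = "\<lambda>s. weight m u s"
  have "(\<Sum>s\<in>grid m. ?w s * ?g (node m s))
      = (\<Sum>s\<in>grid m. sqrt (real n) * (?w s * empirical_copula x n (node m s)) - sqrt (real n) * (?w s * C (node m s)))"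
    by (intro sum.cong refl) (simp add: emp_process_def node_in_unit_cube algebra_simps)
  also have "\<dots> = sqrt (real n) * (bernstein m (empirical_copula x n) u - bernstein m C u)"
    by (simp add: bernstein_eq_weighted_sum sum_subtractf right_diff_distrib flip: sum_distrib_left)
  finally have "emp_bernstein_process C x n m u - ?g u
      = (\<Sum>s\<in>grid m. ?w s * (?g (node m s) - ?g u)) + sqrt (real n) * (bernstein m C u - C u)"
    using u by (simp add: emp_bernstein_process_def right_diff_distrib sum_subtractf sum_weight
        flip: sum_distrib_right)
  then have "\<bar>emp_bernstein_process C x n m u - ?g u\<bar>
      \<le> \<bar>\<Sum>s\<in>grid m. ?w s * (?g (node m s) - ?g u)\<bar> + \<bar>sqrt (real n) * (bernstein m C u - C u)\<bar>"
    by (simp only: abs_triangle_ineq)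
  moreover have "\<bar>\<Sum>s\<in>grid m. ?w s * (?g (node m s) - ?g u)\<bar> \<le> lip_excess k ?g + k * real CARD('d) / sqrt (real \<mu>)"
  proof -
    have "\<bar>\<Sum>s\<in>grid m. ?w s * (?g (node m s) - ?g u)\<bar>
        \<le> (\<Sum>s\<in>grid m. ?w s * (lip_excess k ?g + k * dist (node m s) u))"
      by (rule order_trans[OF sum_abs sum_mono])
         (auto simp: abs_mult weight_nonneg[OF u]
           intro!: mult_left_mono abs_diff_le_lip_excess[OF g \<open>0 \<le> k\<close> node_in_unit_cube u])
    also have "\<dots> = (\<Sum>s\<in>grid m. ?w s * lip_excess k ?g + k * (?w s * dist (node m s) u))"
      by (intro sum.cong refl) (simp add: algebra_simps)
    also have "\<dots> = lip_excess k ?g + k * (\<Sum>s\<in>grid m. ?w s * dist (node m s) u)"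
      by (simp add: sum.distrib sum_weight flip: sum_distrib_left sum_distrib_right)
    also have "\<dots> \<le> lip_excess k ?g + k * (real CARD('d) / sqrt (real \<mu>))"
      by (intro add_left_mono mult_left_mono sum_weight_dist u m \<open>0 \<le> k\<close>)
    finally show ?thesis by simp
  qed
  ultimately show ?thesis by (simp add: abs_mult)
qed

text \<open>The bound on the difference holds at every outcome, and chance enters it only through
  the excess of \<open>Gn\<close>. Each \<open>is_oP1\<close> claim thus reduces to a deterministic
  estimate of \<open>sqrt (real n)\<close> times the bias, at one point or uniformly on the
  cube.\<close>

theorem theorem3p6:
  fixes M :: "'a measure" and N :: "'b measure"
    and X :: "nat \<Rightarrow> 'a \<Rightarrow> real ^ 'd"
    and P :: "(real ^ 'd) measure"
    and C :: "real ^ 'd \<Rightarrow> real"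
    and G :: "'b \<Rightarrow> real ^ 'd \<Rightarrow> real"
    and m :: "nat \<Rightarrow> 'd \<Rightarrow> nat"
  defines "Gn \<equiv> \<lambda>n \<omega>. emp_process C (\<lambda>i. X i \<omega>) n"
    and "Gnm \<equiv> \<lambda>n \<omega>. emp_bernstein_process C (\<lambda>i. X i \<omega>) n (m n)"
    and "mstar \<equiv> \<lambda>n. Min (range (m n))"
  assumes "prob_space M" and "prob_space N"
    and X_measurable: "\<And>i. i \<ge> 1 \<Longrightarrow> X i \<in> borel_measurable M"
    and X_distr: "\<And>i. i \<ge> 1 \<Longrightarrow> distr M borel (X i) = P"
    and P_continuous: "continuous_on UNIV (joint_cdf P)"
    and C_copula: "copula_of P C"
    and C_smooth:
      "\<And>j. has_continuous_partial_on C j {u \<in> unit_cube. 0 < u $ j \<and> u $ j < 1}"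
    and Gn_weak: "converges_weakly (l_infty unit_cube) M Gn N G"
    and G_continuous: "AE \<omega> in N. continuous_on unit_cube (G \<omega>)"
    and m_pos: "\<And>n j. n \<ge> 1 \<Longrightarrow> m n j \<ge> 1"
    and m_infty: "filterlim mstar at_top sequentially"
  shows
    "((\<lambda>n. sqrt (real n)) \<in> o(\<lambda>n. real (mstar n)) \<longrightarrow>
       (\<forall>u. (\<forall>j. 0 < u $ j \<and> u $ j \<le> 1) \<and>
            (\<exists>\<epsilon>. \<epsilon> > 0 \<and>
              (\<forall>j. u $ j < 1 \<longrightarrow>
                 0 < u $ j - \<epsilon> \<and> u $ j + \<epsilon> < 1 \<and>
                 (\<exists>K. K-lipschitz_on {w \<in> unit_cube. infnorm (w - u) \<le> \<epsilon>}
                        (partial_deriv C j)))) \<longrightarrow>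
            is_oP1 M (\<lambda>n \<omega>. Gnm n \<omega> u - Gn n \<omega> u)))
     \<and>
     (liminf (\<lambda>n. ereal (real (mstar n) / real n)) > 0 \<longrightarrow>
       is_oP1 M (\<lambda>n \<omega>. SUP u \<in> unit_cube. \<bar>Gnm n \<omega> u - Gn n \<omega> u\<bar>) \<and>
       converges_weakly (l_infty unit_cube) M Gnm N G)"
proof -
  have C: "is_copula C" using C_copula by (simp add: copula_of_def)
  let ?D = "real CARD('d)"
  have Gn: "Gn n \<omega> \<in> mspace (l_infty unit_cube)" if "\<omega> \<in> space M" for n \<omega>
    using Gn_weak that unfolding converges_weakly_def by blast
  have Gnm: "Gnm n \<omega> \<in> mspace (l_infty unit_cube)" for n \<omega>
    unfolding Gnm_def by (rule emp_bernstein_process_in_l_infty[OF C])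
  have mstar_le: "mstar n \<le> m n j" for n j
    unfolding mstar_def by (rule Min_le) auto
  have mstar_ge: "1 \<le> mstar n" if "1 \<le> n" for n
    unfolding mstar_def using m_pos[OF that] by (subst Min_ge_iff) auto
  have diff: "\<bar>Gnm n \<omega> u - Gn n \<omega> u\<bar> \<le> lip_excess (real k) (Gn n \<omega>)
      + real k * ?D / sqrt (real (mstar n)) + sqrt (real n) * \<bar>bernstein (m n) C u - C u\<bar>"
    if "\<omega> \<in> space M" "u \<in> unit_cube" "1 \<le> n" for n k \<omega> u
    unfolding Gnm_def Gn_def
    by (rule emp_bernstein_process_diff[OF Gn[OF that(1), unfolded Gn_def] that(2) _ mstar_ge[OF that(3)] mstar_le])
       simp
  have mstar_real: "filterlim (\<lambda>n. real (mstar n)) at_top sequentially"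
    by (rule filterlim_compose[OF filterlim_real_sequentially m_infty])
  have sqrt_small: "eventually (\<lambda>n. K / sqrt (f n) < \<delta>) sequentially"
    if "filterlim f at_top sequentially" "0 < \<delta>" for K \<delta> and f :: "nat \<Rightarrow> real"
  proof -
    have "filterlim (\<lambda>n. sqrt (f n)) at_top sequentially"
      by (rule filterlim_compose[OF sqrt_at_top that(1)])
    then have "(\<lambda>n. K / sqrt (f n)) \<longlonglongrightarrow> 0"
      by (intro tendsto_divide_0[OF tendsto_const] filterlim_at_top_imp_at_infinity)
    then show ?thesis using that(2) by (rule order_tendstoD(2))
  qed
  show ?thesis
  proof (intro conjI impI allI)
    fix u
    assume small: "(\<lambda>n. sqrt (real n)) \<in> o(\<lambda>n. real (mstar n))"
      and u: "(\<forall>j. 0 < u $ j \<and> u $ j \<le> 1) \<and>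
            (\<exists>\<epsilon>. \<epsilon> > 0 \<and>
              (\<forall>j. u $ j < 1 \<longrightarrow>
                 0 < u $ j - \<epsilon> \<and> u $ j + \<epsilon> < 1 \<and>
                 (\<exists>K. K-lipschitz_on {w \<in> unit_cube. infnorm (w - u) \<le> \<epsilon>}
                        (partial_deriv C j))))"
    have u01: "\<And>j. 0 < u $ j \<and> u $ j \<le> 1" using u by blast
    then have cube: "u \<in> unit_cube" by (simp add: unit_cube_def less_imp_le)
    obtain \<epsilon> where \<epsilon>: "\<epsilon> > 0" "\<And>j. u $ j < 1 \<Longrightarrow>
        \<exists>K. K-lipschitz_on {w \<in> unit_cube. infnorm (w - u) \<le> \<epsilon>} (partial_deriv C j)"
      using u by blast
    obtain K where K: "0 \<le> K" "\<And>(m :: 'd \<Rightarrow> nat) \<mu>. 1 \<le> \<mu> \<Longrightarrow> (\<And>j. \<mu> \<le> m j) \<Longrightarrow>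
        \<bar>bernstein m C u - C u\<bar> \<le> K / real \<mu>"
      using bernstein_bias_pointwise[OF C C_smooth u01 \<epsilon>] by blast
    have "(\<lambda>n. sqrt (real n) / real (mstar n)) \<longlonglongrightarrow> 0" by (rule smalloD_tendsto[OF small])
    then have ratio: "(\<lambda>n. K * (sqrt (real n) / real (mstar n))) \<longlonglongrightarrow> 0"
      by (rule tendsto_mult_right_zero)
    show "is_oP1 M (\<lambda>n \<omega>. Gnm n \<omega> u - Gn n \<omega> u)"
    proof (rule is_oP1_lip_excess[OF \<open>prob_space M\<close> \<open>prob_space N\<close> Gn_weak G_continuous])
      fix k and \<delta> :: real assume "0 < \<delta>"
      have "eventually (\<lambda>n. K * (sqrt (real n) / real (mstar n)) < \<delta> / 2) sequentially"
        using ratio \<open>0 < \<delta>\<close> by (intro order_tendstoD(2)[where y=0]) auto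
      moreover have "eventually (\<lambda>n. real k * ?D / sqrt (real (mstar n)) < \<delta> / 2) sequentially"
        using \<open>0 < \<delta>\<close> by (intro sqrt_small mstar_real) simp
      ultimately show "eventually (\<lambda>n. \<forall>\<omega>\<in>space M. \<bar>Gnm n \<omega> u - Gn n \<omega> u\<bar>
          \<le> lip_excess (real k) (Gn n \<omega>) + \<delta>) sequentially"
        using eventually_ge_at_top[of 1]
      proof eventually_elim
        case (elim n)
        have "sqrt (real n) * \<bar>bernstein (m n) C u - C u\<bar> \<le> sqrt (real n) * (K / real (mstar n))"
          by (intro mult_left_mono K(2) mstar_ge mstar_le elim) simp
        also have "\<dots> = K * (sqrt (real n) / real (mstar n))" by simp
        finally have "\<bar>Gnm n \<omega> u - Gn n \<omega> u\<bar> \<le> lip_excess (real k) (Gn n \<omega>) + \<delta>"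
          if "\<omega> \<in> space M" for \<omega>
          using elim(1,2) diff[OF that cube elim(3), of k] by linarith
        then show ?case by blast
      qed
    qed
  next
    assume "liminf (\<lambda>n. ereal (real (mstar n) / real n)) > 0"
    then obtain c' where c': "0 < c'" "c' < liminf (\<lambda>n. ereal (real (mstar n) / real n))"
      using dense by blast
    then obtain c where c: "0 < c" "ereal c < liminf (\<lambda>n. ereal (real (mstar n) / real n))"
      by (cases c') auto
    \<comment> \<open>A positive lower limit means that \<open>mstar n\<close> eventually exceeds
      \<open>c * n\<close>, which lets both bias terms be measured against
      \<open>sqrt (real n)\<close>.\<close>
    have linear: "eventually (\<lambda>n. c < real (mstar n) / real n) sequentially"
      using less_LiminfD[OF c(2)] by simp
    let ?Z = "\<lambda>n \<omega>. SUP u \<in> unit_cube. \<bar>Gnm n \<omega> u - Gn n \<omega> u\<bar>"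
    show oP: "is_oP1 M ?Z"
    proof (rule is_oP1_lip_excess[OF \<open>prob_space M\<close> \<open>prob_space N\<close> Gn_weak G_continuous])
      fix k and \<delta> :: real assume "0 < \<delta>"
      \<comment> \<open>After multiplication by \<open>sqrt (real n)\<close> the first bias term is
        at most \<open>e / sqrt c\<close>, that is \<open>\<delta> / 4\<close>. The second is
        \<open>K / c\<close> over \<open>sqrt (real n)\<close>, eventually below
        \<open>\<delta> / 4\<close>; the remaining \<open>\<delta> / 2\<close> is for the mean
        distance.\<close>
      define e where "e = \<delta> * sqrt c / 4"
      have "0 < e" using \<open>0 < \<delta>\<close> c by (simp add: e_def)
      obtain K where K: "0 \<le> K" "\<And>(m :: 'd \<Rightarrow> nat) \<mu> (u :: real ^ 'd). u \<in> unit_cube \<Longrightarrow> 1 \<le> \<mu> \<Longrightarrow>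
          (\<And>j. \<mu> \<le> m j) \<Longrightarrow> \<bar>bernstein m C u - C u\<bar> \<le> e / sqrt (real \<mu>) + K / real \<mu>"
        using bernstein_bias_uniform[OF C C_smooth \<open>0 < e\<close>] by blast
      have "eventually (\<lambda>n. (K / c) / sqrt (real n) < \<delta> / 4) sequentially"
        using \<open>0 < \<delta>\<close> by (intro sqrt_small filterlim_real_sequentially) simp
      moreover have "eventually (\<lambda>n. real k * ?D / sqrt (real (mstar n)) < \<delta> / 2) sequentially"
        using \<open>0 < \<delta>\<close> by (intro sqrt_small mstar_real) simp
      ultimately show "eventually (\<lambda>n. \<forall>\<omega>\<in>space M. \<bar>?Z n \<omega>\<bar>
          \<le> lip_excess (real k) (Gn n \<omega>) + \<delta>) sequentially"
        using linear eventually_ge_at_top[of 1]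
      proof eventually_elim
        case (elim n)
        have n: "0 < real n" using elim(4) by simp
        have cn: "c * real n \<le> real (mstar n)" using elim(3) n by (simp add: field_simps)
        have pos: "0 < real (mstar n)" using cn mult_pos_pos[OF c(1) n] by linarith
        have bias: "sqrt (real n) * \<bar>bernstein (m n) C u - C u\<bar> \<le> \<delta> / 2" if "u \<in> unit_cube" for u
        proof -
          have "\<bar>bernstein (m n) C u - C u\<bar> \<le> e / sqrt (real (mstar n)) + K / real (mstar n)"
            by (intro K(2) that mstar_ge mstar_le elim)
          also have "\<dots> \<le> e / sqrt (c * real n) + K / (c * real n)"
            using cn n c(1) pos K(1) \<open>0 < e\<close> by (intro add_mono divide_left_mono mult_pos_pos) simp_all
          finally have "sqrt (real n) * \<bar>bernstein (m n) C u - C u\<bar>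
              \<le> sqrt (real n) * (e / sqrt (c * real n) + K / (c * real n))"
            by (rule mult_left_mono) simp
          also have "\<dots> = e / sqrt c + (K / c) / sqrt (real n)"
          proof -
            have "sqrt (real n) * (e / sqrt (c * real n)) = e / sqrt c"
              using n c(1) by (simp add: real_sqrt_mult)
            moreover have "sqrt (real n) * (K / (c * real n)) = (K / c) * (sqrt (real n) / real n)"
              by simp
            moreover have "sqrt (real n) / real n = 1 / sqrt (real n)"
              using n by (simp add: real_div_sqrt divide_simps)
            ultimately show ?thesis by (simp add: distrib_left)
          qed
          also have "e / sqrt c = \<delta> / 4" using c(1) by (simp add: e_def)
          finally show ?thesis using elim(1) by linarith
        qed
        show ?case
        proof
          fix \<omega> assume \<omega>: "\<omega> \<in> space M"
          let ?b = "lip_excess (real k) (Gn n \<omega>) + \<delta>"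
          have b: "\<bar>Gnm n \<omega> u - Gn n \<omega> u\<bar> \<le> ?b" if "u \<in> unit_cube" for u
            using diff[OF \<omega> that elim(4), of k] bias[OF that] elim(2) by linarith
          have "?Z n \<omega> \<le> ?b"
            by (rule cSUP_least) (use zero_in_unit_cube b in blast)+
          \<comment> \<open>The value at the origin is nonnegative, and the bound \<open>?b\<close>
            makes the supremum a genuine upper bound of it.\<close>
          moreover have "0 \<le> ?Z n \<omega>"
            by (rule cSUP_upper2[OF bdd_aboveI2[OF b] zero_in_unit_cube]) simp_all
          ultimately show "\<bar>?Z n \<omega>\<bar> \<le> ?b" by simp
        qed
      qed
    qed
    have dist: "mdist (l_infty unit_cube) (Gnm n \<omega>) (Gn n \<omega>) = ?Z n \<omega>" if "\<omega> \<in> space M" for n \<omega>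
      by (rule mdist_l_infty[OF Gnm Gn[OF that]]) (use zero_in_unit_cube in blast)
    show "converges_weakly (l_infty unit_cube) M Gnm N G"
    proof (rule converges_weakly_oP1[OF \<open>prob_space M\<close> \<open>prob_space N\<close> Gn_weak])
      \<comment> \<open>The rewriting is done inside the event because \<open>Gn n \<omega>\<close>
        is known to be bounded only for \<open>\<omega> \<in> space M\<close>.\<close>
      have "{\<omega> \<in> space M. \<bar>mdist (l_infty unit_cube) (Gnm n \<omega>) (Gn n \<omega>)\<bar> > \<delta>}
          = {\<omega> \<in> space M. \<bar>?Z n \<omega>\<bar> > \<delta>}" for n \<delta>
        by (intro Collect_cong conj_cong refl) (simp only: dist)
      then show "is_oP1 M (\<lambda>n \<omega>. mdist (l_infty unit_cube) (Gnm n \<omega>) (Gn n \<omega>))"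
        using oP unfolding is_oP1_def by simp
    qed (use Gnm in blast)
  qed
qed

end
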